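(* Let $N\geqslant 1$, and let $\Omega\subseteq\mathbb{R}^N$ be an open set which is bounded in the $\sigma$-direction for some $\sigma\in\mathbb{S}^{N-1}$, i.e. $\sup_{x\in\Omega}|x\cdot\sigma|<+\infty$. Then, for every $p\in[1,+\infty)$, $$\|u\|_{L^p(\Omega)}\leqslant p\,c_{\Omega,\sigma}\,\|\partial_\sigma u\|_{L^p(\Omega)}\qquad\forall u\in W^{1,p}_0(\Omega),$$ where $$c_{\Omega,\sigma}:=\inf_{x_0\in\mathbb{R}^N}\ \sup_{x\in\Omega}|(x-x_0)\cdot\sigma|,$$ a constant depending only on the projection of $\Omega$ onto the $\sigma$-direction.
   Context: $\mathbb{S}^{N-1}$ is the unit sphere of $\mathbb{R}^N$; $\partial_\sigma u=\nabla u\cdot\sigma$ is the (weak) directional derivative in direction $\sigma$. $W^{1,p}_0(\Omega)$ is the closure in the Sobolev space $W^{1,p}(\Omega)$ of $C^\infty_c(\Omega)$, the space of infinitely differentiable real-valued functions with compact support in $\Omega$. The projection of $\Omega$ onto the $\sigma$-direction is $\{t\in\mathbb{R}: t=x\cdot\sigma\text{ for some }x\in\Omega\}$. *)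

theory Defs
  imports "HOL-Analysis.Analysis"
begin

text \<open>Elements of function spaces over \<open>\<Omega>\<close> are represented by total functions; integration against
  \<^term>\<open>lebesgue_on \<Omega>\<close> makes the values outside \<open>\<Omega>\<close> (and on null sets) irrelevant.\<close>

definition Lp :: "'a::euclidean_space set \<Rightarrow> real \<Rightarrow> ('a \<Rightarrow> 'b::euclidean_space) set" where
  "Lp \<Omega> p = {f \<in> borel_measurable (lebesgue_on \<Omega>). integrable (lebesgue_on \<Omega>) (\<lambda>x. norm (f x) powr p)}"

text \<open>Meaningful only for members of \<^const>\<open>Lp\<close>: the Bochner integral of a non-integrable function
  is \<open>0\<close>.\<close>

definition Lp_norm :: "'a::euclidean_space set \<Rightarrow> real \<Rightarrow> ('a \<Rightarrow> 'b::euclidean_space) \<Rightarrow> real" where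
  "Lp_norm \<Omega> p f = (LINT x|lebesgue_on \<Omega>. norm (f x) powr p) powr (1 / p)"

definition L1_loc :: "'a::euclidean_space set \<Rightarrow> ('a \<Rightarrow> 'b::euclidean_space) set" where
  "L1_loc \<Omega> = {f. \<forall>K. compact K \<and> K \<subseteq> \<Omega> \<longrightarrow> set_integrable lebesgue K f}"

text \<open>\<open>Ck k f\<close>: \<open>f\<close> is \<open>k\<close> times continuously differentiable on the whole space. At \<open>Suc k\<close>
  all directional derivatives are required to be \<open>Ck k\<close>.\<close>

primrec Ck :: "nat \<Rightarrow> ('a::euclidean_space \<Rightarrow> real) \<Rightarrow> bool" where
  "Ck 0 f \<longleftrightarrow> continuous_on UNIV f"
| "Ck (Suc k) f \<longleftrightarrow> (\<forall>x. f differentiable (at x)) \<and> (\<forall>v. Ck k (\<lambda>x. frechet_derivative f (at x) v))"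

text \<open>\<open>C\<^sub>c\<^sup>\<infinity>(\<Omega>)\<close>, with test functions extended by zero outside \<open>\<Omega>\<close>.\<close>

definition test_functions :: "'a::euclidean_space set \<Rightarrow> ('a \<Rightarrow> real) set" where
  "test_functions \<Omega> = {\<phi>. (\<forall>k. Ck k \<phi>) \<and> compact (closure {x. \<phi> x \<noteq> 0}) \<and> closure {x. \<phi> x \<noteq> 0} \<subseteq> \<Omega>}"

definition has_weak_gradient ::
    "'a::euclidean_space set \<Rightarrow> ('a \<Rightarrow> real) \<Rightarrow> ('a \<Rightarrow> 'a) \<Rightarrow> bool" where
  "has_weak_gradient \<Omega> u G \<longleftrightarrow> u \<in> L1_loc \<Omega> \<and> G \<in> L1_loc \<Omega> \<and>
     (\<forall>\<phi> \<in> test_functions \<Omega>. \<forall>b \<in> Basis.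
        (LINT x|lebesgue_on \<Omega>. u x * frechet_derivative \<phi> (at x) b)
          = - (LINT x|lebesgue_on \<Omega>. (G x \<bullet> b) * \<phi> x))"

text \<open>The weak gradient is unique almost everywhere on open \<open>\<Omega>\<close>; some version of it is picked.\<close>

definition weak_gradient :: "'a::euclidean_space set \<Rightarrow> ('a \<Rightarrow> real) \<Rightarrow> 'a \<Rightarrow> 'a" where
  "weak_gradient \<Omega> u = (SOME G. has_weak_gradient \<Omega> u G)"

definition weak_dir_deriv :: "'a::euclidean_space set \<Rightarrow> 'a \<Rightarrow> ('a \<Rightarrow> real) \<Rightarrow> 'a \<Rightarrow> real" where
  "weak_dir_deriv \<Omega> \<sigma> u = (\<lambda>x. weak_gradient \<Omega> u x \<bullet> \<sigma>)"

definition W1p :: "'a::euclidean_space set \<Rightarrow> real \<Rightarrow> ('a \<Rightarrow> real) set" where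
  "W1p \<Omega> p = {u \<in> Lp \<Omega> p. \<exists>G \<in> Lp \<Omega> p. has_weak_gradient \<Omega> u G}"

text \<open>One of the usual equivalent norms; they all give the same closure of \<open>C\<^sub>c\<^sup>\<infinity>(\<Omega>)\<close>.\<close>

definition W1p_norm :: "'a::euclidean_space set \<Rightarrow> real \<Rightarrow> ('a \<Rightarrow> real) \<Rightarrow> real" where
  "W1p_norm \<Omega> p u = Lp_norm \<Omega> p u + Lp_norm \<Omega> p (weak_gradient \<Omega> u)"

definition W1p_0 :: "'a::euclidean_space set \<Rightarrow> real \<Rightarrow> ('a \<Rightarrow> real) set" where
  "W1p_0 \<Omega> p = {u \<in> W1p \<Omega> p. \<forall>\<epsilon>>0. \<exists>\<phi> \<in> test_functions \<Omega>. W1p_norm \<Omega> p (\<lambda>x. u x - \<phi> x) < \<epsilon>}"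

definition bounded_in_direction :: "'a::euclidean_space \<Rightarrow> 'a set \<Rightarrow> bool" where
  "bounded_in_direction \<sigma> \<Omega> \<longleftrightarrow> bdd_above ((\<lambda>x. \<bar>x \<bullet> \<sigma>\<bar>) ` \<Omega>)"

definition projection :: "'a::euclidean_space \<Rightarrow> 'a set \<Rightarrow> real set" where
  "projection \<sigma> \<Omega> = {t. \<exists>x \<in> \<Omega>. t = x \<bullet> \<sigma>}"

text \<open>A genuine infimum of suprema when \<open>\<Omega>\<close> is nonempty and bounded in direction \<open>\<sigma>\<close>. For
  \<open>\<Omega> = {}\<close> it is the unspecified real \<^term>\<open>Sup {} :: real\<close>.\<close>

definition c_const :: "'a::euclidean_space set \<Rightarrow> 'a \<Rightarrow> real" where
  "c_const \<Omega> \<sigma> = (INF x0. SUP x\<in>\<Omega>. \<bar>(x - x0) \<bullet> \<sigma>\<bar>)"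

end

theory Submission
  imports Defs
begin

text \<open>
  For a test function \<open>\<phi>\<close> supported in the slab \<open>\<bar>(x - x\<^sub>0) \<bullet> \<sigma>\<bar> < c\<close>, cut the space at the middle
  hyperplane of the slab. From any point, moving by \<open>c\<close> in direction \<open>\<sigma>\<close> (on the upper half) or
  \<open>-\<sigma>\<close> (on the lower half) leaves the support without leaving the half space, so \<open>\<phi>(x)\<close> is a
  telescoping sum of \<open>n\<close> increments with step \<open>c/n\<close>. The power mean inequality and translation
  invariance of Lebesgue measure bound \<open>\<integral>\<bar>\<phi>\<bar>\<^sup>p\<close> over the half space by \<open>c\<^sup>p\<close> times the integral of
  the \<open>p\<close>-th power of the difference quotient, which converges to \<open>\<partial>\<^sub>\<sigma>\<phi>\<close>. This gives the inequality
  with \<open>c\<close> in place of \<open>p c\<close>, and no case distinction at \<open>p = 1\<close>. It passes to \<open>W\<^sub>0\<^sup>1\<^sup>,\<^sup>p\<close> by density;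
  here uniqueness of the weak gradient is needed, as \<^const>\<open>weak_gradient\<close> picks an arbitrary version.
\<close>

section \<open>Smooth bump functions on boxes\<close>

lemma Ck_const [simp]: "Ck k (\<lambda>x. c)"
  by (induction k arbitrary: c) auto

lemma Ck_SucD: "Ck (Suc k) f \<Longrightarrow> Ck k f"
proof (induction k arbitrary: f)
  case 0
  then show ?case
    by (auto simp: continuous_on_eq_continuous_at intro: differentiable_imp_continuous_within)
next
  case (Suc k)
  then show ?case by (meson Ck.simps(2))
qed

lemma Ck_differentiable: "Ck (Suc k) f \<Longrightarrow> f differentiable (at x)"
  by simp

lemma Ck_add: "Ck k f \<Longrightarrow> Ck k g \<Longrightarrow> Ck k (\<lambda>x. f x + g x)"
proof (induction k arbitrary: f g)
  case 0
  then show ?case by (auto intro: continuous_intros)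
next
  case (Suc k)
  have "frechet_derivative (\<lambda>x. f x + g x) (at x) =
      (\<lambda>v. frechet_derivative f (at x) v + frechet_derivative g (at x) v)" for x
    using Suc.prems by (intro frechet_derivative_at[symmetric] has_derivative_add)
      (auto simp: frechet_derivative_works)
  with Suc show ?case by (auto intro: differentiable_add)
qed

lemma Ck_mult: "Ck k f \<Longrightarrow> Ck k g \<Longrightarrow> Ck k (\<lambda>x. f x * g x)"
proof (induction k arbitrary: f g)
  case 0
  then show ?case by (auto intro: continuous_intros)
next
  case (Suc k)
  have "frechet_derivative (\<lambda>x. f x * g x) (at x) =
      (\<lambda>v. f x * frechet_derivative g (at x) v + frechet_derivative f (at x) v * g x)" for x
    using Suc.prems by (intro frechet_derivative_at[symmetric] has_derivative_mult)
      (auto simp: frechet_derivative_works)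
  moreover have "Ck k f" "Ck k g"
    using Suc.prems Ck_SucD by blast+
  ultimately show ?case using Suc by (auto intro: differentiable_mult Ck_add)
qed

lemma Ck_prod: "(\<And>i. i \<in> I \<Longrightarrow> Ck k (f i)) \<Longrightarrow> Ck k (\<lambda>x. \<Prod>i\<in>I. f i x)"
  by (induction I rule: infinite_finite_induct) (auto intro: Ck_mult)

text \<open>The polynomial factor makes this class of functions closed under differentiation.\<close>

definition exp_recip :: "real poly \<Rightarrow> real \<Rightarrow> real" where
  "exp_recip P t = (if t > 0 then poly P (1 / t) * exp (- (1 / t)) else 0)"

text \<open>The exponential beats each monomial of \<open>P\<close>. Read with s = 1/t, this is the
  flatness of exp(-1/t) at 0, even after multiplication by a polynomial in 1/t.\<close>

lemma tendsto_poly_div_exp_0: "((\<lambda>s. poly P s / exp s) \<longlongrightarrow> (0::real)) at_top"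
proof -
  have "((\<lambda>s. \<Sum>i\<le>degree P. coeff P i * (s ^ i / exp s)) \<longlongrightarrow> (\<Sum>i\<le>degree P. coeff P i * 0)) at_top"
    by (intro tendsto_intros tendsto_power_div_exp_0)
  then show ?thesis
    by (simp add: poly_altdef sum_divide_distrib)
qed

text \<open>With s = 1/t, d/dt equals -s^2 d/ds, and d/ds turns P(s) exp(-s) into (P' - P)(s)
  exp(-s). The factor \<open>[:0, 0, 1:]\<close> is the polynomial s^2. The two one-sided limits
  settle t = 0.\<close>

lemma exp_recip_DERIV:
  "(exp_recip P has_real_derivative exp_recip ([:0, 0, 1:] * (P - pderiv P)) t) (at t)"
proof -
  consider "t > 0" | "t < 0" | "t = 0" by linarith
  then show ?thesis
  proof cases
    case 1
    have "((\<lambda>t. poly P (1 / t) * exp (- (1 / t))) has_real_derivative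
        exp_recip ([:0, 0, 1:] * (P - pderiv P)) t) (at t)"
      using 1 unfolding exp_recip_def
      by (auto intro!: derivative_eq_intros poly_DERIV[THEN DERIV_chain2] simp: field_simps power2_eq_square)
    then show ?thesis
      by (rule has_field_derivative_transform_within_open[where S="{0<..}"])
        (use 1 in \<open>auto simp: exp_recip_def\<close>)
  next
    case 2
    have "((\<lambda>t. 0) has_real_derivative exp_recip ([:0, 0, 1:] * (P - pderiv P)) t) (at t)"
      using 2 by (simp add: exp_recip_def)
    then show ?thesis
      by (rule has_field_derivative_transform_within_open[where S="{..<0}"])
        (use 2 in \<open>auto simp: exp_recip_def\<close>)
  next
    case 3
    have "((\<lambda>h. (exp_recip P h - exp_recip P 0) / h) \<longlongrightarrow> 0) (at_right 0)"
    proof -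
      \<comment> \<open>\<open>pCons 0 P\<close> is s P(s): dividing by h in the difference quotient
        costs one more power of s = 1/h.\<close>
      have "((\<lambda>h. poly (pCons 0 P) (inverse h) / exp (inverse h)) \<longlongrightarrow> 0) (at_right 0)"
        by (rule filterlim_compose[OF tendsto_poly_div_exp_0 filterlim_inverse_at_top_right])
      then show ?thesis
        by (rule Lim_transform_eventually)
          (auto simp: eventually_at_right_less exp_recip_def exp_minus field_simps
            intro: eventually_mono[OF eventually_at_right_less])
    qed
    moreover have "((\<lambda>h. (exp_recip P h - exp_recip P 0) / h) \<longlongrightarrow> 0) (at_left 0)"
      by (rule Lim_transform_eventually[OF tendsto_const])
        (auto simp: exp_recip_def eventually_at_left_field intro!: exI[of _ "-1"])
    ultimately show ?thesis
      using 3 by (simp add: has_field_derivative_iff filterlim_split_at exp_recip_def)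
  qed
qed

text \<open>A directional derivative is again such a function, with another polynomial, times a
  constant. Hence the induction on \<open>k\<close> with \<open>P\<close> arbitrary.\<close>

lemma Ck_exp_recip_affine: "Ck k (\<lambda>x. exp_recip P (c * (x \<bullet> b - d)))"
proof (induction k arbitrary: P)
  case 0
  have "isCont (exp_recip P) t" for t
    using exp_recip_DERIV DERIV_isCont by blast
  then have "continuous_on UNIV (exp_recip P)"
    by (simp add: continuous_at_imp_continuous_on)
  from continuous_on_compose2[OF this, of UNIV "\<lambda>x. c * (x \<bullet> b - d)"]
  show ?case by (simp add: continuous_intros)
next
  case (Suc k)
  have D: "((\<lambda>x. exp_recip P (c * (x \<bullet> b - d))) has_derivative
      (\<lambda>v. exp_recip ([:0, 0, 1:] * (P - pderiv P)) (c * (x \<bullet> b - d)) * (c * (v \<bullet> b)))) (at x)" for x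
    by (rule has_derivative_compose[of "\<lambda>x. c * (x \<bullet> b - d)" "\<lambda>v. c * (v \<bullet> b)", OF _
          exp_recip_DERIV[unfolded has_field_derivative_def]])
      (auto intro!: derivative_eq_intros)
  show ?case
    using D Suc.IH unfolding Ck.simps frechet_derivative_at[OF D, symmetric]
    by (auto intro: differentiableI Ck_mult Ck_const)
qed

text \<open>A smooth approximation from below of the indicator of \<open>box a b\<close>: with m = n
  + 1, a factor is exp(-1/(m t)) for t > 0 and 0 otherwise, and for t > 0 it tends to 1 as n
  grows.\<close>

definition box_bump :: "'a::euclidean_space \<Rightarrow> 'a \<Rightarrow> nat \<Rightarrow> 'a \<Rightarrow> real" where
  "box_bump a b n x = (\<Prod>i\<in>Basis. exp_recip 1 (real (Suc n) * (x \<bullet> i - a \<bullet> i))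
     * exp_recip 1 (real (Suc n) * (b \<bullet> i - x \<bullet> i)))"

lemma Ck_box_bump: "Ck k (box_bump a b n)"
proof -
  \<comment> \<open>This brings the factors for the upper faces into the affine form of
    \<open>Ck_exp_recip_affine\<close>, with negative slope.\<close>
  have "real (Suc n) * (b \<bullet> i - x \<bullet> i) = - real (Suc n) * (x \<bullet> i - b \<bullet> i)" for x i
    by (simp add: algebra_simps)
  then show ?thesis
    unfolding box_bump_def by (simp only:) (intro Ck_prod Ck_mult Ck_exp_recip_affine)
qed

lemma exp_recip_1_bounds: "0 \<le> exp_recip 1 t" "exp_recip 1 t \<le> 1"
  by (auto simp: exp_recip_def)

lemma box_bump_eq_0:
  assumes "x \<notin> box a b" shows "box_bump a b n x = 0"
proof -
  from assms obtain i where "i \<in> Basis" "x \<bullet> i \<le> a \<bullet> i \<or> b \<bullet> i \<le> x \<bullet> i"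
    by (auto simp: mem_box not_less)
  then show ?thesis
    unfolding box_bump_def
    by (intro prod_zero bexI[of _ i]) (auto simp: exp_recip_def zero_less_mult_iff)
qed

lemma box_bump_bounds: "0 \<le> box_bump a b n x" "box_bump a b n x \<le> 1"
  unfolding box_bump_def
  by (auto intro!: prod_nonneg prod_le_1 mult_nonneg_nonneg mult_le_one exp_recip_1_bounds)

lemma exp_recip_scaled_LIMSEQ:
  assumes "t > 0" shows "(\<lambda>n. exp_recip 1 (real (Suc n) * t)) \<longlonglongrightarrow> 1"
proof -
  have "(\<lambda>n. exp (- (inverse (real (Suc n)) * (1 / t)))) \<longlonglongrightarrow> exp (- (0 * (1 / t)))"
    by (intro tendsto_intros LIMSEQ_inverse_real_of_nat)
  moreover have "exp_recip 1 (real (Suc n) * t) = exp (- (inverse (real (Suc n)) * (1 / t)))" for n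
    using assms by (simp add: exp_recip_def inverse_eq_divide del: of_nat_Suc)
  ultimately show ?thesis
    by simp
qed

lemma box_bump_LIMSEQ: "(\<lambda>n. box_bump a b n x) \<longlonglongrightarrow> indicat_real (box a b) x"
proof (cases "x \<in> box a b")
  case True
  have "(\<lambda>n. \<Prod>i\<in>Basis. exp_recip 1 (real (Suc n) * (x \<bullet> i - a \<bullet> i))
     * exp_recip 1 (real (Suc n) * (b \<bullet> i - x \<bullet> i))) \<longlonglongrightarrow> (\<Prod>i\<in>(Basis::'a set). 1 * 1)"
    using True by (intro tendsto_intros exp_recip_scaled_LIMSEQ) (auto simp: mem_box)
  then show ?thesis
    using True by (simp add: box_bump_def del: of_nat_Suc)
qed (simp add: box_bump_eq_0)

text \<open>The closed box is required to lie in \<Omega> because the closure of the support can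
  reach the faces of the box.\<close>

lemma box_bump_test_function:
  assumes "cbox a b \<subseteq> \<Omega>" shows "box_bump a b n \<in> test_functions \<Omega>"
proof -
  have "closure {x. box_bump a b n x \<noteq> 0} \<subseteq> cbox a b"
    using box_bump_eq_0 box_subset_cbox by (intro closure_minimal) fastforce+
  with assms show ?thesis
    using compact_Int_closed[OF compact_cbox closed_closure, of a b "{x. box_bump a b n x \<noteq> 0}"]
    by (auto simp: test_functions_def Ck_box_bump Int_absorb1)
qed

section \<open>The fundamental lemma of the calculus of variations\<close>

lemma eq_0_outside_support: "x \<notin> closure {x. f x \<noteq> 0} \<Longrightarrow> f x = 0"
  using closure_subset[of "{x. f x \<noteq> 0}"] by blast

lemma test_functionD:
  assumes "\<phi> \<in> test_functions \<Omega>"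
  shows "Ck k \<phi>" "compact (closure {x. \<phi> x \<noteq> 0})" "closure {x. \<phi> x \<noteq> 0} \<subseteq> \<Omega>"
  using assms unfolding test_functions_def by blast+

text \<open>An open set is a countable union of closed boxes; \<open>h\<close> is integrable, hence
  measurable, on each of them, and the pieces glue.\<close>

lemma L1_loc_measurable:
  fixes h :: "'a::euclidean_space \<Rightarrow> 'b::euclidean_space"
  assumes "open \<Omega>" "h \<in> L1_loc \<Omega>"
  shows "h \<in> borel_measurable (lebesgue_on \<Omega>)"
proof -
  obtain \<D> where \<D>: "countable \<D>" "\<D> \<subseteq> Pow \<Omega>" "\<And>X. X \<in> \<D> \<Longrightarrow> \<exists>a b. X = cbox a b" "\<Union>\<D> = \<Omega>"
    using open_countable_Union_open_cbox[OF \<open>open \<Omega>\<close>] by metis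
  show ?thesis
  proof (rule measurable_piecewise_restrict[OF \<D>(1)])
    fix X assume X: "X \<in> \<D>"
    then obtain a b where ab: "X = cbox a b" "cbox a b \<subseteq> \<Omega>" using \<D> by blast
    then show "X \<inter> space (lebesgue_on \<Omega>) \<in> sets (lebesgue_on \<Omega>)"
      using \<open>open \<Omega>\<close> by (simp add: sets_restrict_space_iff Int_absorb2)
    have "set_integrable lebesgue X h"
      using assms(2) ab by (auto simp: L1_loc_def)
    then have "integrable (lebesgue_on X) h"
      using ab by (simp add: set_integrable_def integrable_restrict_space)
    moreover have "restrict_space (lebesgue_on \<Omega>) X = lebesgue_on X"
      using ab by (simp add: restrict_restrict_space Int_absorb1 \<open>open \<Omega>\<close>)
    ultimately show "h \<in> borel_measurable (restrict_space (lebesgue_on \<Omega>) X)" by auto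
  qed (use \<D> in auto)
qed

text \<open>\<open>f\<close> is bounded by some \<open>B\<close> on the compact \<open>K\<close> and
  vanishes off it, so B times the restriction of \<open>h\<close> to \<open>K\<close> dominates the
  product. It serves for \<open>f\<close> a test function or a partial derivative of one.\<close>

lemma L1_loc_scaleR_integrable:
  fixes h :: "'a::euclidean_space \<Rightarrow> 'b::euclidean_space"
  assumes "\<Omega> \<in> sets lebesgue" "h \<in> L1_loc \<Omega>" "continuous_on UNIV f" "compact K" "K \<subseteq> \<Omega>"
    and "\<And>x. x \<notin> K \<Longrightarrow> f x = (0::real)"
  shows "integrable (lebesgue_on \<Omega>) (\<lambda>x. f x *\<^sub>R h x)"
proof -
  have K: "integrable lebesgue (\<lambda>x. indicator K x *\<^sub>R h x)"
    using assms by (auto simp: L1_loc_def set_integrable_def)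
  have "compact (f ` K)"
    using assms(3,4) by (auto intro: compact_continuous_image continuous_on_subset)
  then obtain B where B: "\<And>x. x \<in> K \<Longrightarrow> \<bar>f x\<bar> \<le> B"
    by (meson bounded_real compact_imp_bounded imageI)
  have "f \<in> borel_measurable lebesgue"
    using assms(3) by (simp add: borel_measurable_continuous_onI measurable_completion)
  moreover have "norm (f x *\<^sub>R indicator K x *\<^sub>R h x) \<le> norm (B *\<^sub>R indicator K x *\<^sub>R h x)" for x
    using B[of x] by (auto simp: indicator_def intro!: mult_right_mono)
  ultimately have "integrable lebesgue (\<lambda>x. f x *\<^sub>R indicator K x *\<^sub>R h x)"
    using K by (intro Bochner_Integration.integrable_bound[OF integrable_scaleR_right[OF K, of B]])
      (auto simp del: norm_scaleR scaleR_scaleR simp: borel_measurable_scaleR)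
  also have "(\<lambda>x. f x *\<^sub>R indicator K x *\<^sub>R h x) = (\<lambda>x. indicator \<Omega> x *\<^sub>R f x *\<^sub>R h x)"
    using assms(5,6) by (intro ext) (auto simp: indicator_def)
  finally show ?thesis
    using assms(1) by (simp add: integrable_restrict_space)
qed

lemma test_function_mult_integrable:
  fixes h :: "'a::euclidean_space \<Rightarrow> real"
  assumes "open \<Omega>" "h \<in> L1_loc \<Omega>" "\<phi> \<in> test_functions \<Omega>"
  shows "integrable (lebesgue_on \<Omega>) (\<lambda>x. h x * \<phi> x)"
proof -
  have "integrable (lebesgue_on \<Omega>) (\<lambda>x. \<phi> x *\<^sub>R h x)"
  proof (rule L1_loc_scaleR_integrable[OF _ assms(2) _ test_functionD(2,3)[OF assms(3)]])
    show "\<phi> x = 0" if "x \<notin> closure {x. \<phi> x \<noteq> 0}" for x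
      using that by (rule eq_0_outside_support)
  qed (use assms(1) test_functionD(1)[OF assms(3), of 0] in auto)
  then show ?thesis by (simp add: mult.commute)
qed

text \<open>The bumps are test functions, bounded by 1 and converging to the indicator of the open
  box. Dominated convergence, with |h| on the closed box as majorant, gives integral 0 over the open
  box; the faces are null.\<close>

lemma integral_cbox_eq_0:
  fixes h :: "'a::euclidean_space \<Rightarrow> real"
  assumes "open \<Omega>" "h \<in> L1_loc \<Omega>" "cbox a b \<subseteq> \<Omega>"
    and "\<And>\<phi>. \<phi> \<in> test_functions \<Omega> \<Longrightarrow> (LINT x|lebesgue_on \<Omega>. h x * \<phi> x) = 0"
  shows "integral (cbox a b) h = 0"
proof -
  have \<Omega>: "\<Omega> \<in> sets lebesgue" using assms(1) by simp
  have c: "integrable lebesgue (\<lambda>x. indicator (cbox a b) x *\<^sub>R h x)"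
    using assms by (auto simp: L1_loc_def set_integrable_def)
  then have "integrable lebesgue (\<lambda>x. indicator (box a b) x *\<^sub>R indicator (cbox a b) x *\<^sub>R h x)"
    by (rule integrable_mult_indicator[rotated]) auto
  also have "(\<lambda>x. indicator (box a b) x *\<^sub>R indicator (cbox a b) x *\<^sub>R h x) = (\<lambda>x. indicator (box a b) x *\<^sub>R h x)"
    using box_subset_cbox[of a b] by (intro ext) (auto simp: indicator_def)
  finally have box: "integrable (lebesgue_on (box a b)) h"
    by (simp add: integrable_restrict_space)
  have [measurable]: "h \<in> borel_measurable (lebesgue_on \<Omega>)"
    using assms L1_loc_measurable by blast
  have [measurable]: "box_bump a b n \<in> borel_measurable (lebesgue_on \<Omega>)" for n
    using Ck_box_bump[of 0 a b n]
    by (intro measurable_restrict_space1 measurable_completion) (simp add: borel_measurable_continuous_onI)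
  have "(\<lambda>n. LINT x|lebesgue_on \<Omega>. h x * box_bump a b n x)
      \<longlonglongrightarrow> (LINT x|lebesgue_on \<Omega>. h x * indicat_real (box a b) x)"
  proof (rule integral_dominated_convergence)
    have "integrable lebesgue (\<lambda>x. indicator \<Omega> x *\<^sub>R indicator (cbox a b) x *\<^sub>R h x)"
      using c \<Omega> by (rule integrable_mult_indicator[rotated])
    then show "integrable (lebesgue_on \<Omega>) (\<lambda>x. norm (indicator (cbox a b) x *\<^sub>R h x))"
      using \<Omega> by (intro integrable_norm) (simp add: integrable_restrict_space)
    show "AE x in lebesgue_on \<Omega>. (\<lambda>n. h x * box_bump a b n x) \<longlonglongrightarrow> h x * indicat_real (box a b) x"
      by (intro AE_I2 tendsto_intros box_bump_LIMSEQ)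
    show "AE x in lebesgue_on \<Omega>. norm (h x * box_bump a b n x) \<le> norm (indicator (cbox a b) x *\<^sub>R h x)" for n
    proof (rule AE_I2)
      fix x
      show "norm (h x * box_bump a b n x) \<le> norm (indicator (cbox a b) x *\<^sub>R h x)"
        using box_bump_bounds[of a b n x] box_bump_eq_0[of x a b n] subsetD[OF box_subset_cbox, of x a b]
        by (cases "x \<in> box a b") (simp_all add: abs_mult mult_left_le)
    qed
    show "(\<lambda>x. h x * indicat_real (box a b) x) \<in> borel_measurable (lebesgue_on \<Omega>)"
      using borel_measurable_indicator[of "box a b" lebesgue]
      by (intro borel_measurable_times[OF \<open>h \<in> borel_measurable (lebesgue_on \<Omega>)\<close>] measurable_restrict_space1) auto
  qed auto
  then have "(LINT x|lebesgue_on \<Omega>. h x * indicat_real (box a b) x) = 0"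
    using assms(4)[OF box_bump_test_function[OF assms(3)]] by (simp add: LIMSEQ_const_iff)
  then have "(LINT x|lebesgue. indicator \<Omega> x *\<^sub>R (h x * indicat_real (box a b) x)) = 0"
    using \<Omega> by (simp add: integral_restrict_space)
  also have "(\<lambda>x. indicator \<Omega> x *\<^sub>R (h x * indicat_real (box a b) x)) = (\<lambda>x. indicator (box a b) x *\<^sub>R h x)"
    using box_subset_cbox[of a b] assms(3) by (intro ext) (auto simp: indicator_def)
  finally have "(LINT x|lebesgue_on (box a b). h x) = 0"
    by (simp add: integral_restrict_space)
  then show ?thesis
    using has_integral_integral_lebesgue_on[OF box] by (simp add: integral_open_interval[symmetric] integral_unique)
qed

text \<open>The averages of \<open>h\<close> over small boxes at almost every point converge to \<open>h\<close>, and they all vanish.\<close>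

lemma du_Bois_Reymond:
  fixes h :: "'a::euclidean_space \<Rightarrow> real"
  assumes "open \<Omega>" "h \<in> L1_loc \<Omega>"
    and "\<And>\<phi>. \<phi> \<in> test_functions \<Omega> \<Longrightarrow> (LINT x|lebesgue_on \<Omega>. h x * \<phi> x) = 0"
  shows "AE x in lebesgue_on \<Omega>. h x = 0"
proof -
  have box: "negligible {x \<in> cbox a b. h x \<noteq> 0}" if ab: "cbox a b \<subseteq> \<Omega>" for a b
  proof -
    \<comment> \<open>The extension by zero is integrable on every box of the space, as Lebesgue
      differentiation demands.\<close>
    define f where "f x = (if x \<in> cbox a b then h x else 0)" for x
    have "integrable (lebesgue_on (cbox a b)) h"
      using assms(2) ab by (auto simp: L1_loc_def set_integrable_def integrable_restrict_space)
    then have "h integrable_on cbox a b"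
      by (simp add: integrable_on_lebesgue_on)
    then have "f integrable_on UNIV"
      unfolding f_def by (simp add: integrable_restrict_UNIV)
    then have "f integrable_on cbox c d" for c d
      using integrable_on_subcbox by blast
    then obtain N where N: "negligible N"
       "\<And>x e. x \<notin> N \<Longrightarrow> 0 < e \<Longrightarrow>
               \<exists>d>0. \<forall>h. 0 < h \<and> h < d \<longrightarrow>
                         norm(integral (cbox x (x + h *\<^sub>R One)) f /\<^sub>R h ^ DIM('a) - f x) < e"
      using integrable_ccontinuous_explicit[of f] by metis
    have "h x = 0" if x: "x \<in> box a b" "x \<notin> N" for x
    proof (rule ccontr)
      assume "h x \<noteq> 0"
      \<comment> \<open>The tolerance |h x| is chosen for the contradiction: an average equal to 0
        has distance exactly |h x| from h x, against the strict bound.\<close>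
      with N(2)[OF x(2), of "\<bar>h x\<bar>"] obtain d where d: "d > 0"
        "\<And>r. 0 < r \<Longrightarrow> r < d \<Longrightarrow> norm(integral (cbox x (x + r *\<^sub>R One)) f /\<^sub>R r ^ DIM('a) - f x) < \<bar>h x\<bar>"
        by auto
      \<comment> \<open>The cube used for averaging has \<open>x\<close> as its lower corner, so a
        side below the distances to the upper faces keeps it in the box.\<close>
      have "eventually (\<lambda>r. \<forall>i\<in>Basis. r < (b - x) \<bullet> i) (at_right 0)"
        using x(1) by (intro eventually_ball_finite ballI eventually_at_rightI[of 0 "(b - x) \<bullet> i" for i])
          (auto simp: mem_box inner_diff_left)
      moreover have "eventually (\<lambda>r. r < d) (at_right 0)"
        using d(1) by (auto intro: eventually_at_rightI[of 0 d])
      ultimately have "eventually (\<lambda>r. (\<forall>i\<in>Basis. r < (b - x) \<bullet> i) \<and> r < d \<and> 0 < r) (at_right 0)"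
        using eventually_at_right_less[of "0::real"] by eventually_elim auto
      then obtain r where r: "\<And>i. i \<in> Basis \<Longrightarrow> r < (b - x) \<bullet> i" "r < d" "0 < r"
        by (metis (mono_tags, lifting) eventually_happens trivial_limit_at_right_real)
      have sub: "cbox x (x + r *\<^sub>R One) \<subseteq> cbox a b"
      proof
        fix y assume y: "y \<in> cbox x (x + r *\<^sub>R One)"
        show "y \<in> cbox a b"
          unfolding mem_box
        proof (intro ballI conjI)
          fix i :: 'a assume i: "i \<in> Basis"
          with y have "x \<bullet> i \<le> y \<bullet> i" "y \<bullet> i \<le> x \<bullet> i + r"
            by (auto simp: mem_box inner_add_left)
          then show "a \<bullet> i \<le> y \<bullet> i" "y \<bullet> i \<le> b \<bullet> i"
            using x(1) r(1)[OF i] i by (auto simp: mem_box inner_diff_left less_imp_le dest!: bspec[of _ _ i])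
        qed
      qed
      have "integral (cbox x (x + r *\<^sub>R One)) f = integral (cbox x (x + r *\<^sub>R One)) h"
        using sub by (intro integral_cong) (auto simp: f_def)
      also have "\<dots> = 0"
        using sub ab assms by (intro integral_cbox_eq_0[of \<Omega>]) auto
      finally show False
        using d(2)[OF r(3,2)] x(1) box_subset_cbox[of a b] by (auto simp: f_def)
    qed
    then have "{x \<in> cbox a b. h x \<noteq> 0} \<subseteq> N \<union> (cbox a b - box a b)" by auto
    then show ?thesis
      using negligible_subset negligible_Un[OF N(1) negligible_frontier_interval] by blast
  qed
  obtain \<D> where \<D>: "countable \<D>" "\<D> \<subseteq> Pow \<Omega>" "\<And>X. X \<in> \<D> \<Longrightarrow> \<exists>a b. X = cbox a b" "\<Union>\<D> = \<Omega>"
    using open_countable_Union_open_cbox[OF \<open>open \<Omega>\<close>] by metis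
  have "negligible (\<Union>X\<in>\<D>. {x \<in> X. h x \<noteq> 0})"
    using \<D> box by (intro negligible_countable_Union) (auto, blast)
  then have "(\<Union>X\<in>\<D>. {x \<in> X. h x \<noteq> 0}) \<in> null_sets lebesgue"
    by (simp add: negligible_iff_null_sets)
  then have "AE x in lebesgue. x \<in> \<Omega> \<longrightarrow> h x = 0"
    by (rule AE_I') (use \<D>(4) in auto)
  then show ?thesis
    using \<open>open \<Omega>\<close> by (simp add: AE_restrict_space_iff)
qed

section \<open>Difference quotients of compactly supported functions\<close>

lemma frechet_derivative_eq_0_outside_support:
  fixes f :: "'a::euclidean_space \<Rightarrow> real"
  assumes "x \<notin> closure {x. f x \<noteq> 0}"
  shows "frechet_derivative f (at x) v = 0"
proof -
  have "(f has_derivative (\<lambda>v. 0)) (at x)"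
    by (rule has_derivative_transform_within_open[OF has_derivative_const[of 0], of "- closure {x. f x \<noteq> 0}"])
      (use assms closure_subset[of "{x. f x \<noteq> 0}"] in auto)
  then show ?thesis
    by (simp add: frechet_derivative_at[symmetric])
qed

lemma Ck_Suc_0_DERIV:
  assumes "Ck (Suc 0) f"
  shows "((\<lambda>s. f (x + s *\<^sub>R v)) has_real_derivative frechet_derivative f (at (x + s *\<^sub>R v)) v) (at s)"
proof -
  let ?D = "frechet_derivative f (at (x + s *\<^sub>R v))"
  have D: "(f has_derivative ?D) (at (x + s *\<^sub>R v))"
    using assms frechet_derivative_works by auto
  have "((\<lambda>s. f (x + s *\<^sub>R v)) has_derivative (\<lambda>t. ?D (t *\<^sub>R v))) (at s)"
    by (rule has_derivative_compose[of "\<lambda>s. x + s *\<^sub>R v", OF _ D]) (auto intro!: derivative_eq_intros)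
  moreover have "?D (t *\<^sub>R v) = ?D v * t" for t
    using linear_scale[OF has_derivative_linear[OF D]] by simp
  ultimately show ?thesis
    by (simp add: has_field_derivative_def)
qed

lemma frechet_derivative_bounded:
  fixes f :: "'a::euclidean_space \<Rightarrow> real"
  assumes "Ck (Suc 0) f" "compact (closure {x. f x \<noteq> 0})"
  obtains M where "\<And>x. \<bar>frechet_derivative f (at x) v\<bar> \<le> M"
proof -
  let ?K = "closure {x. f x \<noteq> 0}"
  have "compact ((\<lambda>x. frechet_derivative f (at x) v) ` ?K)"
    using assms by (intro compact_continuous_image) (auto intro: continuous_on_subset)
  then obtain B where "\<And>x. x \<in> ?K \<Longrightarrow> \<bar>frechet_derivative f (at x) v\<bar> \<le> B"
    by (meson bounded_real compact_imp_bounded imageI)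
  then have "\<bar>frechet_derivative f (at x) v\<bar> \<le> max B 0" for x
    using frechet_derivative_eq_0_outside_support[of x f v] by (cases "x \<in> ?K") (auto simp: le_max_iff_disj)
  then show ?thesis by (rule that)
qed

text \<open>Dominated convergence: by the mean value theorem the quotients obey any bound of the
  derivative, and for steps up to \<open>c\<close> they vanish off one ball, where \<Phi> 0 = 0
  makes the integrand vanish too. It is applied with \<Phi> the identity and with \<Phi> the p-th
  power of the absolute value.\<close>

lemma difference_quotient_integral_LIMSEQ:
  fixes f :: "'a::euclidean_space \<Rightarrow> real"
  defines "D \<equiv> \<lambda>h x v. (f (x + h *\<^sub>R v) - f x) / h"
  assumes f: "Ck (Suc 0) f" "compact (closure {x. f x \<noteq> 0})"
    and \<Phi>: "continuous_on UNIV \<Phi>" "\<Phi> 0 = (0::real)" and [measurable]: "H \<in> sets borel" and "c > 0"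
  shows "integrable lborel (\<lambda>x. indicator H x * \<Phi> (D (c / Suc n) x v))" (is ?I1)
    and "integrable lborel (\<lambda>x. indicator H x * \<Phi> (frechet_derivative f (at x) v))" (is ?I2)
    and "(\<lambda>n. LINT x|lborel. indicator H x * \<Phi> (D (c / Suc n) x v))
      \<longlonglongrightarrow> (LINT x|lborel. indicator H x * \<Phi> (frechet_derivative f (at x) v))" (is ?L)
proof -
  let ?K = "closure {x. f x \<noteq> 0}"
  obtain M where M: "\<And>x. \<bar>frechet_derivative f (at x) v\<bar> \<le> M"
    using frechet_derivative_bounded[OF f] by metis
  have "compact (\<Phi> ` {-M..M})"
    using \<Phi> by (intro compact_continuous_image) (auto intro: continuous_on_subset)
  then obtain B where "\<And>y. y \<in> {-M..M} \<Longrightarrow> \<bar>\<Phi> y\<bar> \<le> B"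
    by (meson bounded_real compact_imp_bounded imageI)
  then have B: "\<bar>\<Phi> y\<bar> \<le> B" if "\<bar>y\<bar> \<le> M" for y
    using that by (auto simp: abs_le_iff)
  have D_le: "\<bar>D h x v\<bar> \<le> M" if "h > 0" for h x
  proof -
    have "\<exists>z>0. z < h \<and> f (x + h *\<^sub>R v) - f (x + 0 *\<^sub>R v) = (h - 0) * frechet_derivative f (at (x + z *\<^sub>R v)) v"
      by (rule MVT2[OF that Ck_Suc_0_DERIV[OF f(1)]])
    then obtain z where "f (x + h *\<^sub>R v) - f x = h * frechet_derivative f (at (x + z *\<^sub>R v)) v"
      by auto
    then show ?thesis using M that by (simp add: D_def)
  qed
  obtain r where r: "\<And>x. x \<in> ?K \<Longrightarrow> norm x \<le> r"
    using f(2) compact_imp_bounded bounded_iff by metis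
  \<comment> \<open>The radius of the support, enlarged by the length of the longest step: beyond it
    neither \<open>x\<close> nor the shifted point meets the support.\<close>
  define R where "R = r + c * norm v"
  have out: "D h x v = 0" if "0 < h" "h \<le> c" "x \<notin> cball 0 R" for h x
  proof -
    have "norm (h *\<^sub>R v) \<le> c * norm v" using that by (simp add: mult_right_mono)
    moreover have "norm x \<le> norm (x + h *\<^sub>R v) + norm (h *\<^sub>R v)"
      using norm_triangle_ineq4[of "x + h *\<^sub>R v" "h *\<^sub>R v"] by simp
    moreover have "0 \<le> c * norm v" "norm x > R" using \<open>c > 0\<close> that by auto
    ultimately have "x + h *\<^sub>R v \<notin> ?K" "x \<notin> ?K"
      using r[of x] r[of "x + h *\<^sub>R v"] unfolding R_def by linarith+
    then have "f (x + h *\<^sub>R v) = 0" "f x = 0"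
      using eq_0_outside_support[of _ f] by blast+
    then show ?thesis by (simp add: D_def)
  qed
  have [measurable]: "f \<in> borel_measurable borel"
    using Ck_SucD[OF f(1)] by (simp add: borel_measurable_continuous_onI)
  have [measurable]: "(\<lambda>x. frechet_derivative f (at x) v) \<in> borel_measurable borel"
    using f(1) by (simp add: borel_measurable_continuous_onI)
  have [measurable]: "\<Phi> \<in> borel_measurable borel"
    using \<Phi> by (simp add: borel_measurable_continuous_onI)
  have [measurable]: "(\<lambda>x. D h x v) \<in> borel_measurable borel" for h
    unfolding D_def by measurable
  have w: "integrable lborel (\<lambda>x. indicator (cball (0::'a) R) x *\<^sub>R B)"
    by (intro borel_integrable_compact) auto
  have lim: "AE x in lborel. (\<lambda>n. indicator H x * \<Phi> (D (c / Suc n) x v))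
      \<longlonglongrightarrow> indicator H x * \<Phi> (frechet_derivative f (at x) v)"
  proof (intro AE_I2 tendsto_mult tendsto_const)
    fix x
    have "((\<lambda>h. D h x v) \<longlongrightarrow> frechet_derivative f (at x) v) (at 0)"
      using Ck_Suc_0_DERIV[OF f(1), of x v 0] by (simp add: has_field_derivative_iff D_def)
    \<comment> \<open>The steps tend to 0 without ever being 0, which the punctured filter
      \<open>at 0\<close> requires.\<close>
    moreover have "filterlim (\<lambda>n. c / Suc n) (at 0) sequentially"
      using tendsto_mult_right_zero[OF LIMSEQ_inverse_real_of_nat, of c] \<open>c > 0\<close>
      by (simp add: filterlim_at divide_inverse)
    ultimately have "(\<lambda>n. D (c / Suc n) x v) \<longlonglongrightarrow> frechet_derivative f (at x) v"
      by (rule filterlim_compose)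
    then show "(\<lambda>n. \<Phi> (D (c / Suc n) x v)) \<longlonglongrightarrow> \<Phi> (frechet_derivative f (at x) v)"
      using \<Phi>(1) by (intro isCont_tendsto_compose[of _ \<Phi>]) (auto simp: continuous_on_eq_continuous_at)
  qed
  have bound: "AE x in lborel. norm (indicator H x * \<Phi> (D (c / Suc n) x v)) \<le> indicator (cball 0 R) x *\<^sub>R B" for n
  proof (rule AE_I2)
    fix x
    have "0 < c / Suc n" "c / Suc n \<le> c"
      using \<open>c > 0\<close> by (auto simp: field_simps)
    then show "norm (indicator H x * \<Phi> (D (c / Suc n) x v)) \<le> indicator (cball 0 R) x *\<^sub>R B"
      using B[OF D_le, of "c / Suc n" x] out[of "c / Suc n" x] \<Phi>(2)
      by (cases "x \<in> cball 0 R") (auto simp: indicator_def)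
  qed
  note * = _ _ w lim bound
  show ?I1 by (rule integrable_dominated_convergence2[OF *]) measurable
  show ?I2 by (rule integrable_dominated_convergence[OF *]) measurable
  show ?L by (rule integral_dominated_convergence[OF *]) measurable
qed

section \<open>Translation invariance and integrals of derivatives\<close>

lemma lborel_integral_translate:
  fixes F :: "'a::euclidean_space \<Rightarrow> real"
  assumes "F \<in> borel_measurable borel"
  shows "(LINT x|lborel. F (x + a)) = (LINT x|lborel. F x)"
    and "integrable lborel F \<Longrightarrow> integrable lborel (\<lambda>x. F (x + a))"
proof -
  have T: "(\<lambda>x. x + a) = (+) a" by (auto simp: add.commute)
  have "distr lborel borel (\<lambda>x. x + a) = lborel"
    unfolding T by (rule lborel_distr_plus)
  with integral_distr[of "\<lambda>x. x + a" lborel borel F] integrable_distr[of "\<lambda>x. x + a" lborel borel F] assms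
  show "(LINT x|lborel. F (x + a)) = (LINT x|lborel. F x)"
    and "integrable lborel F \<Longrightarrow> integrable lborel (\<lambda>x. F (x + a))"
    by simp_all
qed

lemma compact_support_integrable:
  fixes f :: "'a::euclidean_space \<Rightarrow> real"
  assumes "continuous_on UNIV f" "compact K" "\<And>x. x \<notin> K \<Longrightarrow> f x = 0"
  shows "integrable lborel f"
proof -
  have "integrable lborel (\<lambda>x. indicator K x *\<^sub>R f x)"
    using assms by (intro borel_integrable_compact) (auto intro: continuous_on_subset)
  also have "(\<lambda>x. indicator K x *\<^sub>R f x) = f"
    using assms(3) by (intro ext) (auto simp: indicator_def)
  finally show ?thesis .
qed

text \<open>The integrals of the difference quotients vanish by translation invariance.\<close>

lemma integral_frechet_derivative_eq_0:
  fixes f :: "'a::euclidean_space \<Rightarrow> real"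
  assumes f: "Ck (Suc 0) f" "compact (closure {x. f x \<noteq> 0})"
  shows "(LINT x|lborel. frechet_derivative f (at x) v) = 0"
proof -
  have int: "integrable lborel f"
    by (rule compact_support_integrable[OF _ f(2) eq_0_outside_support]) (use Ck_SucD[OF f(1)] in auto)
  then have *: "(LINT x|lborel. (f (x + h *\<^sub>R v) - f x) / h) = 0" for h
    using lborel_integral_translate[of f "h *\<^sub>R v"] by simp
  have "(\<lambda>n. 0) \<longlonglongrightarrow> (LINT x|lborel. frechet_derivative f (at x) v)"
    using difference_quotient_integral_LIMSEQ(3)[OF f, of id UNIV 1 v]
    unfolding id_apply indicator_UNIV mult_1_left * by (simp add: continuous_on_id)
  then show ?thesis
    by (simp add: LIMSEQ_const_iff)
qed

section \<open>The inequality on a half space\<close>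

lemma powr_convex_nonneg:
  assumes "p \<ge> 1" shows "convex_on {0..} (\<lambda>x::real. x powr p)"
proof (rule convex_onI)
  fix t x y :: real
  assume *: "0 < t" "t < 1" "x \<in> {0..}" "y \<in> {0..}"
  \<comment> \<open>This treats the boundary of the half line: if one of the points is 0, convexity
    reduces to s^p \<le> s for the weight s of the other point.\<close>
  have le: "s powr p \<le> s" if "0 < s" "s < 1" for s :: real
    using powr_mono'[OF assms, of s] that by simp
  consider "x > 0" "y > 0" | "x = 0" | "y = 0" using * by force
  then show "((1 - t) *\<^sub>R x + t *\<^sub>R y) powr p \<le> (1 - t) * x powr p + t * y powr p"
  proof cases
    case 1
    then show ?thesis
      using convex_onD[OF powr_convex[OF assms], of t x y] * by simp
  qed (use * le[of t] le[of "1 - t"] in \<open>auto simp: powr_mult intro!: mult_right_mono\<close>)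
qed simp

text \<open>Jensen's inequality for t^p with equal weights 1/n, multiplied by n^p.\<close>

lemma sum_powr_le:
  fixes a :: "nat \<Rightarrow> real"
  assumes "p \<ge> 1" "n > 0" "\<And>k. a k \<ge> 0"
  shows "(\<Sum>k<n. a k) powr p \<le> real n powr (p - 1) * (\<Sum>k<n. a k powr p)"
proof -
  have "(\<Sum>k<n. (1 / n) *\<^sub>R a k) powr p \<le> (\<Sum>k<n. (1 / n) * a k powr p)"
    using assms by (intro convex_on_sum[OF _ _ powr_convex_nonneg]) auto
  then have "((\<Sum>k<n. a k) / n) powr p \<le> (\<Sum>k<n. a k powr p) / n"
    by (simp add: sum_divide_distrib)
  then have "(\<Sum>k<n. a k) powr p / n powr p \<le> (\<Sum>k<n. a k powr p) / n"
    using assms by (simp add: powr_divide sum_nonneg)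
  then show ?thesis
    using assms by (simp add: field_simps powr_diff)
qed

text \<open>With m = n + 1 steps of length h = c/m, the constant is c^p already before the limit:
  the power mean inequality gives m^(p-1), the m translates have equal integrals, and the quotients
  carry h^p, so the product is (m h)^p = c^p. Invariance of \<open>H\<close> under shifts along
  \<open>v\<close> keeps the intermediate points in \<open>H\<close>.\<close>

lemma poincare_half_space:
  fixes f :: "'a::euclidean_space \<Rightarrow> real"
  assumes f: "Ck (Suc 0) f" "compact (closure {x. f x \<noteq> 0})"
    and H: "H \<in> sets borel" "\<And>x h. x \<in> H \<Longrightarrow> 0 \<le> h \<Longrightarrow> x + h *\<^sub>R v \<in> H"
    and c: "c > 0" "\<And>x. x \<in> H \<Longrightarrow> f (x + c *\<^sub>R v) = 0" and "p \<ge> 1"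
  shows "(LINT x|lborel. indicator H x * \<bar>f x\<bar> powr p)
    \<le> c powr p * (LINT x|lborel. indicator H x * \<bar>frechet_derivative f (at x) v\<bar> powr p)"
proof -
  have cont: "continuous_on UNIV (\<lambda>t::real. \<bar>t\<bar> powr p)"
    using \<open>p \<ge> 1\<close> by (intro continuous_on_powr') (auto intro: continuous_intros)
  note L = difference_quotient_integral_LIMSEQ[OF f cont _ H(1) c(1), where v=v]
  have fc: "continuous_on UNIV f"
    using Ck_SucD[OF f(1)] by simp
  have [measurable]: "f \<in> borel_measurable borel" "H \<in> sets borel"
    using fc H by (auto intro: borel_measurable_continuous_onI)
  have "integrable lborel (\<lambda>x. \<bar>f x\<bar> powr p)"
  proof (rule compact_support_integrable[OF continuous_on_compose2[OF cont fc] f(2)])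
    fix x assume "x \<notin> closure {x. f x \<noteq> 0}"
    then have "f x = 0" by (rule eq_0_outside_support)
    then show "\<bar>f x\<bar> powr p = 0" by simp
  qed simp
  then have If: "integrable lborel (\<lambda>x. indicator H x * \<bar>f x\<bar> powr p)"
    using integrable_mult_indicator[of H lborel "\<lambda>x. \<bar>f x\<bar> powr p"] by simp
  have "(LINT x|lborel. indicator H x * \<bar>f x\<bar> powr p) \<le> c powr p *
      (LINT x|lborel. indicator H x * \<bar>(f (x + (c / Suc n) *\<^sub>R v) - f x) / (c / Suc n)\<bar> powr p)" for n
  proof -
    define h where "h = c / Suc n"
    have h: "h > 0" "Suc n * h = c" using c by (auto simp: h_def)
    define D where "D x = \<bar>(f (x + h *\<^sub>R v) - f x) / h\<bar> powr p" for x
    \<comment> \<open>The indicator is part of \<open>G\<close>, so that each translate of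
      \<open>G\<close> can be integrated over the whole space, where translation invariance
      holds.\<close>
    define G where "G x = indicator H x * D x" for x
    have [measurable]: "G \<in> borel_measurable borel" unfolding G_def D_def by measurable
    have IG: "integrable lborel G"
      using L(1)[where n=n] \<open>p \<ge> 1\<close> unfolding G_def D_def h_def by simp
    have pt: "indicator H x * \<bar>f x\<bar> powr p
        \<le> Suc n powr (p - 1) * (h powr p * (\<Sum>k<Suc n. G (x + (k * h) *\<^sub>R v)))" for x
    proof (cases "x \<in> H")
      case True
      define d where "d k = f (x + (Suc k * h) *\<^sub>R v) - f (x + (k * h) *\<^sub>R v)" for k
      \<comment> \<open>The sum telescopes; its last value is taken at x + c v, where
        \<open>f\<close> vanishes, so only - f x remains.\<close>
      have "(\<Sum>k<Suc n. d k) = f (x + (Suc n * h) *\<^sub>R v) - f x"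
        unfolding d_def using sum_lessThan_telescope[of "\<lambda>k. f (x + (k * h) *\<^sub>R v)" "Suc n"] by simp
      then have "\<bar>f x\<bar> = \<bar>\<Sum>k<Suc n. d k\<bar>"
        unfolding h(2) using c(2)[OF True] by simp
      also have "\<dots> \<le> (\<Sum>k<Suc n. \<bar>d k\<bar>)" by (rule sum_abs)
      finally have "\<bar>f x\<bar> powr p \<le> (\<Sum>k<Suc n. \<bar>d k\<bar>) powr p"
        using \<open>p \<ge> 1\<close> by (intro powr_mono2) auto
      also have "\<dots> \<le> Suc n powr (p - 1) * (\<Sum>k<Suc n. \<bar>d k\<bar> powr p)"
        using \<open>p \<ge> 1\<close> by (intro sum_powr_le) auto
      also have "(\<Sum>k<Suc n. \<bar>d k\<bar> powr p) = (\<Sum>k<Suc n. h powr p * G (x + (k * h) *\<^sub>R v))"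
      proof (rule sum.cong)
        fix k :: nat
        have "x + (k * h) *\<^sub>R v \<in> H" using H(2)[OF True] h by simp
        then show "\<bar>d k\<bar> powr p = h powr p * G (x + (k * h) *\<^sub>R v)"
          using h(1) by (simp add: G_def D_def d_def powr_divide algebra_simps)
      qed simp
      finally show ?thesis
        using True by (simp add: sum_distrib_left del: sum.lessThan_Suc of_nat_Suc)
    next
      case False
      have "G x \<ge> 0" for x by (simp add: G_def D_def)
      with False show ?thesis
        by (simp add: sum_nonneg del: sum.lessThan_Suc of_nat_Suc)
    qed
    have IGt: "integrable lborel (\<lambda>x. G (x + a))" for a
      using IG by (intro lborel_integral_translate(2)) auto
    have IS: "integrable lborel (\<lambda>x. \<Sum>k<Suc n. G (x + (k * h) *\<^sub>R v))"
      by (intro Bochner_Integration.integrable_sum IGt)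
    have "(LINT x|lborel. indicator H x * \<bar>f x\<bar> powr p)
        \<le> (LINT x|lborel. Suc n powr (p - 1) * (h powr p * (\<Sum>k<Suc n. G (x + (k * h) *\<^sub>R v))))"
      by (rule integral_mono[OF If _ pt]) (intro integrable_mult_right IS)
    also have "\<dots> = Suc n powr (p - 1) * (h powr p * (\<Sum>k<Suc n. LINT x|lborel. G (x + (k * h) *\<^sub>R v)))"
      by (simp add: IGt Bochner_Integration.integral_sum del: sum.lessThan_Suc of_nat_Suc)
    also have "\<dots> = Suc n powr (p - 1) * Suc n * h powr p * (LINT x|lborel. G x)"
      by (simp add: lborel_integral_translate(1) del: sum.lessThan_Suc of_nat_Suc)
    also have "Suc n powr (p - 1) * Suc n = Suc n powr p"
      by (simp add: powr_diff del: of_nat_Suc)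
    also have "Suc n powr p * h powr p = c powr p"
      unfolding h(2)[symmetric] using h(1) by (simp only: powr_mult)
    finally show ?thesis unfolding G_def D_def h_def .
  qed
  note le = this
  have "(\<lambda>n. LINT x|lborel. indicator H x * \<bar>(f (x + (c / Suc n) *\<^sub>R v) - f x) / (c / Suc n)\<bar> powr p)
      \<longlonglongrightarrow> (LINT x|lborel. indicator H x * \<bar>frechet_derivative f (at x) v\<bar> powr p)"
    by (rule L(3)) simp
  from LIMSEQ_le_const[OF tendsto_mult_left[OF this]] show ?thesis
    using le by blast
qed

section \<open>Weak gradients\<close>

definition gradient :: "('a::euclidean_space \<Rightarrow> real) \<Rightarrow> 'a \<Rightarrow> 'a" where
  "gradient f x = (\<Sum>b\<in>Basis. frechet_derivative f (at x) b *\<^sub>R b)"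

lemma gradient_inner:
  assumes "f differentiable (at x)"
  shows "gradient f x \<bullet> v = frechet_derivative f (at x) v"
proof -
  have L: "linear (frechet_derivative f (at x))"
    using assms by (simp add: frechet_derivative_works has_derivative_linear)
  have "frechet_derivative f (at x) v = frechet_derivative f (at x) (\<Sum>b\<in>Basis. (v \<bullet> b) *\<^sub>R b)"
    by (simp add: euclidean_representation)
  also have "\<dots> = (\<Sum>b\<in>Basis. (v \<bullet> b) * frechet_derivative f (at x) b)"
    by (simp add: linear_sum[OF L] linear_scale[OF L])
  finally show ?thesis
    by (simp add: gradient_def inner_sum_left mult.commute inner_commute[of v])
qed

lemma continuous_on_gradient: "Ck (Suc 0) f \<Longrightarrow> continuous_on UNIV (gradient f)"
  unfolding gradient_def by (auto intro!: continuous_intros)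

lemma gradient_eq_0_outside_support: "x \<notin> closure {x. f x \<noteq> 0} \<Longrightarrow> gradient f x = 0"
  unfolding gradient_def by (simp add: frechet_derivative_eq_0_outside_support)

text \<open>This passes from the integrals over \<Omega> in the definitions to
  \<open>lborel\<close>, where the translation arguments take place; Borel measurability allows the
  completion to be dropped.\<close>

lemma integral_lebesgue_on_eq_lborel:
  fixes g :: "'a::euclidean_space \<Rightarrow> real"
  assumes "\<Omega> \<in> sets lebesgue" "g \<in> borel_measurable borel" "\<And>x. x \<notin> \<Omega> \<Longrightarrow> g x = 0"
  shows "(LINT x|lebesgue_on \<Omega>. g x) = (LINT x|lborel. g x)"
proof -
  have "(LINT x|lebesgue_on \<Omega>. g x) = (LINT x|lebesgue. indicator \<Omega> x *\<^sub>R g x)"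
    using assms(1) by (simp add: integral_restrict_space)
  also have "(\<lambda>x. indicator \<Omega> x *\<^sub>R g x) = g"
    using assms(3) by (intro ext) (auto simp: indicator_def)
  finally show ?thesis
    using assms(2) by (simp add: integral_completion)
qed

lemma continuous_L1_loc:
  fixes f :: "'a::euclidean_space \<Rightarrow> 'b::euclidean_space"
  assumes "continuous_on UNIV f" shows "f \<in> L1_loc \<Omega>"
  unfolding L1_loc_def set_integrable_def
proof (intro CollectI allI impI)
  fix K assume K: "compact K \<and> K \<subseteq> \<Omega>"
  then have *: "integrable lborel (\<lambda>x. indicator K x *\<^sub>R f x)"
    using assms by (intro borel_integrable_compact) (auto intro: continuous_on_subset)
  then show "integrable lebesgue (\<lambda>x. indicator K x *\<^sub>R f x)"
    using integrable_completion[OF borel_measurable_integrable[OF *]] by simp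
qed

text \<open>Integration by parts: the product of two test functions is smooth with compact support,
  so its partial derivatives have integral 0, and the product rule splits that integral.\<close>

lemma test_function_has_weak_gradient:
  assumes "open \<Omega>" "\<phi> \<in> test_functions \<Omega>"
  shows "has_weak_gradient \<Omega> \<phi> (gradient \<phi>)"
proof -
  note \<phi> = test_functionD[OF assms(2)]
  have \<Omega>: "\<Omega> \<in> sets lebesgue" using assms(1) by simp
  have "(LINT x|lebesgue_on \<Omega>. \<phi> x * frechet_derivative \<psi> (at x) b)
      = - (LINT x|lebesgue_on \<Omega>. (gradient \<phi> x \<bullet> b) * \<psi> x)" if "\<psi> \<in> test_functions \<Omega>" for \<psi> b
  proof -
    note \<psi> = test_functionD[OF that]
    have diff: "\<phi> differentiable (at x)" "\<psi> differentiable (at x)" for x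
      using \<phi>(1) \<psi>(1) Ck_differentiable by blast+
    have cont: "continuous_on UNIV \<phi>" "continuous_on UNIV \<psi>"
      "continuous_on UNIV (\<lambda>x. frechet_derivative \<phi> (at x) b)"
      "continuous_on UNIV (\<lambda>x. frechet_derivative \<psi> (at x) b)"
      using \<phi>(1)[of 0] \<psi>(1)[of 0] \<phi>(1)[of "Suc 0"] \<psi>(1)[of "Suc 0"] by simp_all
    let ?f = "\<lambda>x. \<phi> x * frechet_derivative \<psi> (at x) b"
    let ?g = "\<lambda>x. frechet_derivative \<phi> (at x) b * \<psi> x"
    have cfg: "continuous_on UNIV ?f" "continuous_on UNIV ?g"
      using cont by (auto intro: continuous_intros)
    have f0: "?f x = 0" and g0: "?g x = 0" if "x \<notin> closure {x. \<phi> x \<noteq> 0}" for x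
      using eq_0_outside_support[OF that] frechet_derivative_eq_0_outside_support[OF that] by simp_all
    have "frechet_derivative (\<lambda>x. \<phi> x * \<psi> x) (at x) =
        (\<lambda>v. \<phi> x * frechet_derivative \<psi> (at x) v + frechet_derivative \<phi> (at x) v * \<psi> x)" for x
      using diff by (intro frechet_derivative_at[symmetric] has_derivative_mult)
        (auto simp: frechet_derivative_works)
    then have prod: "frechet_derivative (\<lambda>x. \<phi> x * \<psi> x) (at x) b = ?f x + ?g x" for x
      by simp
    have "closure {x. \<phi> x * \<psi> x \<noteq> 0} \<subseteq> closure {x. \<phi> x \<noteq> 0}"
      by (intro closure_mono) auto
    then have "compact (closure {x. \<phi> x * \<psi> x \<noteq> 0})"
      using \<phi>(2) by (meson bounded_subset closed_closure compact_eq_bounded_closed)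
    then have "(LINT x|lborel. ?f x + ?g x) = 0"
      using integral_frechet_derivative_eq_0[OF Ck_mult[OF \<phi>(1) \<psi>(1)], of b] unfolding prod by blast
    moreover have "integrable lborel ?f" "integrable lborel ?g"
      using compact_support_integrable[OF cfg(1) \<phi>(2)] compact_support_integrable[OF cfg(2) \<phi>(2)] f0 g0
      by blast+
    ultimately have "(LINT x|lborel. ?f x) = - (LINT x|lborel. ?g x)"
      by simp
    moreover have "(LINT x|lebesgue_on \<Omega>. ?f x) = (LINT x|lborel. ?f x)"
      using \<phi>(3) f0 by (intro integral_lebesgue_on_eq_lborel[OF \<Omega> borel_measurable_continuous_onI[OF cfg(1)]]) blast
    moreover have "(LINT x|lebesgue_on \<Omega>. ?g x) = (LINT x|lborel. ?g x)"
      using \<phi>(3) g0 by (intro integral_lebesgue_on_eq_lborel[OF \<Omega> borel_measurable_continuous_onI[OF cfg(2)]]) blast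
    ultimately show ?thesis
      using diff by (simp add: gradient_inner)
  qed
  moreover have "\<phi> \<in> L1_loc \<Omega>" "gradient \<phi> \<in> L1_loc \<Omega>"
    using \<phi>(1)[of 0] by (simp_all add: continuous_L1_loc continuous_on_gradient[OF \<phi>(1)])
  ultimately show ?thesis
    by (auto simp: has_weak_gradient_def)
qed

lemma L1_loc_diff: "f \<in> L1_loc \<Omega> \<Longrightarrow> g \<in> L1_loc \<Omega> \<Longrightarrow> (\<lambda>x. f x - g x) \<in> L1_loc \<Omega>"
  by (simp add: L1_loc_def set_integral_diff)

lemma L1_loc_inner: 
  fixes f :: "'a::euclidean_space \<Rightarrow> 'b::euclidean_space"
  shows "f \<in> L1_loc \<Omega> \<Longrightarrow> (\<lambda>x. f x \<bullet> b) \<in> L1_loc \<Omega>"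
  unfolding L1_loc_def set_integrable_def
  using integrable_inner_left[of b lebesgue "\<lambda>x. indicator K x *\<^sub>R f x" for K] by simp

lemma has_weak_gradient_diff:
  assumes "open \<Omega>" "has_weak_gradient \<Omega> u G" "has_weak_gradient \<Omega> w F"
  shows "has_weak_gradient \<Omega> (\<lambda>x. u x - w x) (\<lambda>x. G x - F x)"
proof -
  have L: "u \<in> L1_loc \<Omega>" "w \<in> L1_loc \<Omega>" "G \<in> L1_loc \<Omega>" "F \<in> L1_loc \<Omega>"
    using assms by (auto simp: has_weak_gradient_def)
  have "(LINT x|lebesgue_on \<Omega>. (u x - w x) * frechet_derivative \<phi> (at x) b)
      = - (LINT x|lebesgue_on \<Omega>. ((G x - F x) \<bullet> b) * \<phi> x)" if \<phi>: "\<phi> \<in> test_functions \<Omega>" "b \<in> Basis" for \<phi> b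
  proof -
    \<comment> \<open>Linearity of the Bochner integral needs both summands integrable; local
      integrability suffices since the derivative of \<phi> is continuous and supported in a compact
      subset of \<Omega>.\<close>
    have int: "integrable (lebesgue_on \<Omega>) (\<lambda>x. h x * frechet_derivative \<phi> (at x) b)"
      if "h \<in> L1_loc \<Omega>" for h
    proof -
      have "integrable (lebesgue_on \<Omega>) (\<lambda>x. frechet_derivative \<phi> (at x) b *\<^sub>R h x)"
      proof (rule L1_loc_scaleR_integrable[OF _ that _ test_functionD(2,3)[OF \<phi>(1)]])
        show "frechet_derivative \<phi> (at x) b = 0" if "x \<notin> closure {x. \<phi> x \<noteq> 0}" for x
          using that by (rule frechet_derivative_eq_0_outside_support)
      qed (use assms(1) test_functionD(1)[OF \<phi>(1), of "Suc 0"] in auto)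
      then show ?thesis by (simp add: mult.commute)
    qed
    note int' = test_function_mult_integrable[OF assms(1) L1_loc_inner \<phi>(1)]
    have "(LINT x|lebesgue_on \<Omega>. (u x - w x) * frechet_derivative \<phi> (at x) b)
        = (LINT x|lebesgue_on \<Omega>. u x * frechet_derivative \<phi> (at x) b)
        - (LINT x|lebesgue_on \<Omega>. w x * frechet_derivative \<phi> (at x) b)"
      unfolding left_diff_distrib using L by (intro Bochner_Integration.integral_diff int)
    also have "\<dots> = - ((LINT x|lebesgue_on \<Omega>. (G x \<bullet> b) * \<phi> x) - (LINT x|lebesgue_on \<Omega>. (F x \<bullet> b) * \<phi> x))"
      using assms(2,3) \<phi> by (simp add: has_weak_gradient_def)
    also have "\<dots> = - (LINT x|lebesgue_on \<Omega>. ((G x - F x) \<bullet> b) * \<phi> x)"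
      unfolding inner_diff_left left_diff_distrib
      using L by (intro arg_cong[where f=uminus] Bochner_Integration.integral_diff[symmetric] int')
    finally show ?thesis .
  qed
  then show ?thesis
    using L by (simp add: has_weak_gradient_def L1_loc_diff)
qed

text \<open>The difference of the two gradients is a weak gradient of 0, so each component
  integrates to 0 against all test functions, and \<open>du_Bois_Reymond\<close> applies.\<close>

lemma has_weak_gradient_unique:
  assumes "open \<Omega>" "has_weak_gradient \<Omega> u G" "has_weak_gradient \<Omega> u F"
  shows "AE x in lebesgue_on \<Omega>. G x = F x"
proof -
  have "AE x in lebesgue_on \<Omega>. (G x - F x) \<bullet> b = 0" if "b \<in> Basis" for b
  proof (rule du_Bois_Reymond[OF assms(1)])
    have D: "has_weak_gradient \<Omega> (\<lambda>x. 0) (\<lambda>x. G x - F x)"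
      using has_weak_gradient_diff[OF assms] by simp
    then show "(\<lambda>x. (G x - F x) \<bullet> b) \<in> L1_loc \<Omega>"
      by (simp add: has_weak_gradient_def L1_loc_inner)
    show "(LINT x|lebesgue_on \<Omega>. ((G x - F x) \<bullet> b) * \<phi> x) = 0" if "\<phi> \<in> test_functions \<Omega>" for \<phi>
      using D that \<open>b \<in> Basis\<close> by (fastforce simp: has_weak_gradient_def)
  qed
  then have "AE x in lebesgue_on \<Omega>. \<forall>b\<in>Basis. (G x - F x) \<bullet> b = 0"
    by (simp add: AE_finite_all)
  then show ?thesis
    by eventually_elim (simp add: euclidean_all_zero_iff)
qed

lemma has_weak_gradient_weak_gradient:
  assumes "has_weak_gradient \<Omega> u G"
  shows "has_weak_gradient \<Omega> u (weak_gradient \<Omega> u)"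
  unfolding weak_gradient_def using assms by (rule someI[of "has_weak_gradient \<Omega> u"])

section \<open>Lebesgue spaces\<close>

text \<open>Convexity of \<open>t\<^sup>p\<close>, weighted so that Minkowski's inequality follows by integration when \<open>A\<close> and \<open>B\<close>
  bound the two norms.\<close>

lemma norm_add_powr_le:
  fixes x y :: "'b::real_normed_vector"
  assumes "p \<ge> 1" "A > 0" "B > 0"
  shows "norm (x + y) powr p
    \<le> (A + B) powr p * (A / (A + B) * (norm x powr p / A powr p) + B / (A + B) * (norm y powr p / B powr p))"
proof -
  have "norm (x + y) / (A + B) \<le> (1 - B / (A + B)) *\<^sub>R (norm x / A) + (B / (A + B)) *\<^sub>R (norm y / B)"
  proof -
    have "1 - B / (A + B) = A / (A + B)"
      using assms by (simp add: field_simps)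
    moreover have "norm (x + y) / (A + B) \<le> (norm x + norm y) / (A + B)"
      using assms by (intro divide_right_mono norm_triangle_ineq) auto
    ultimately show ?thesis
      using assms by (simp add: add_divide_distrib)
  qed
  then have "(norm (x + y) / (A + B)) powr p
      \<le> ((1 - B / (A + B)) *\<^sub>R (norm x / A) + (B / (A + B)) *\<^sub>R (norm y / B)) powr p"
    using assms by (intro powr_mono2) auto
  also have "\<dots> \<le> (1 - B / (A + B)) * (norm x / A) powr p + B / (A + B) * (norm y / B) powr p"
    using assms by (intro convex_onD[OF powr_convex_nonneg]) (auto simp: field_simps)
  finally have "norm (x + y) powr p / (A + B) powr p
      \<le> A / (A + B) * (norm x powr p / A powr p) + B / (A + B) * (norm y powr p / B powr p)"
    using assms by (simp add: powr_divide field_simps)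
  then show ?thesis
    using assms by (simp add: divide_le_eq mult.commute)
qed

lemma Lp_add:
  assumes "p \<ge> 1" "f \<in> Lp \<Omega> p" "g \<in> Lp \<Omega> p"
  shows "(\<lambda>x. f x + g x) \<in> Lp \<Omega> p"
proof -
  have [measurable]: "f \<in> borel_measurable (lebesgue_on \<Omega>)" "g \<in> borel_measurable (lebesgue_on \<Omega>)"
    and int: "integrable (lebesgue_on \<Omega>) (\<lambda>x. norm (f x) powr p)"
      "integrable (lebesgue_on \<Omega>) (\<lambda>x. norm (g x) powr p)"
    using assms by (auto simp: Lp_def)
  have "integrable (lebesgue_on \<Omega>) (\<lambda>x. norm (f x + g x) powr p)"
  proof (rule Bochner_Integration.integrable_bound)
    show "integrable (lebesgue_on \<Omega>)
        (\<lambda>x. 2 powr p * (1 / 2 * norm (f x) powr p + 1 / 2 * norm (g x) powr p))"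
      using int by auto
    show "AE x in lebesgue_on \<Omega>. norm (norm (f x + g x) powr p)
        \<le> norm (2 powr p * (1 / 2 * norm (f x) powr p + 1 / 2 * norm (g x) powr p))"
      \<comment> \<open>Both weights are 1: |f + g|^p is at most 2^p times the mean of |f|^p and
        |g|^p.\<close>
      using norm_add_powr_le[OF assms(1), of 1 1] by (intro AE_I2) simp
  qed measurable
  then show ?thesis by (simp add: Lp_def)
qed

lemma Lp_norm_nonneg: "0 \<le> Lp_norm \<Omega> p f"
  by (simp add: Lp_norm_def)

lemma Lp_norm_powr:
  assumes "p \<ge> 1" shows "Lp_norm \<Omega> p f powr p = (LINT x|lebesgue_on \<Omega>. norm (f x) powr p)"
  using assms by (simp add: Lp_norm_def powr_powr)

lemma Lp_norm_leI:
  assumes "p \<ge> 1" "0 \<le> A" "(LINT x|lebesgue_on \<Omega>. norm (f x) powr p) \<le> A powr p"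
  shows "Lp_norm \<Omega> p f \<le> A"
proof -
  have "Lp_norm \<Omega> p f \<le> (A powr p) powr (1 / p)"
    unfolding Lp_norm_def using assms by (intro powr_mono2) auto
  then show ?thesis using assms by (simp add: powr_powr)
qed

lemma Lp_norm_triangle:
  assumes "p \<ge> 1" "f \<in> Lp \<Omega> p" "g \<in> Lp \<Omega> p"
  shows "Lp_norm \<Omega> p (\<lambda>x. f x + g x) \<le> Lp_norm \<Omega> p f + Lp_norm \<Omega> p g"
proof (rule field_le_epsilon)
  fix e :: real assume "e > 0"
  \<comment> \<open>The summand e/2 keeps \<open>A\<close> and \<open>B\<close> positive when a norm
    is 0, so that dividing by their p-th powers is legitimate.\<close>
  define A where "A = Lp_norm \<Omega> p f + e / 2"
  define B where "B = Lp_norm \<Omega> p g + e / 2"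
  have AB: "A > 0" "B > 0"
    using \<open>e > 0\<close> Lp_norm_nonneg[of \<Omega> p f] Lp_norm_nonneg[of \<Omega> p g] by (auto simp: A_def B_def)
  let ?F = "LINT x|lebesgue_on \<Omega>. norm (f x) powr p" and ?G = "LINT x|lebesgue_on \<Omega>. norm (g x) powr p"
  have "?F \<le> A powr p" "?G \<le> B powr p"
    unfolding Lp_norm_powr[OF assms(1), symmetric] A_def B_def
    using \<open>e > 0\<close> assms(1) by (auto intro!: powr_mono2 Lp_norm_nonneg)
  then have FG: "?F / A powr p \<le> 1" "?G / B powr p \<le> 1"
    using AB by (simp_all add: divide_le_eq)
  have int: "integrable (lebesgue_on \<Omega>) (\<lambda>x. norm (f x) powr p)"
    "integrable (lebesgue_on \<Omega>) (\<lambda>x. norm (g x) powr p)"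
    "integrable (lebesgue_on \<Omega>) (\<lambda>x. norm (f x + g x) powr p)"
    using assms Lp_add[OF assms] by (auto simp: Lp_def)
  have "(LINT x|lebesgue_on \<Omega>. norm (f x + g x) powr p) \<le> (LINT x|lebesgue_on \<Omega>.
      (A + B) powr p * (A / (A + B) * (norm (f x) powr p / A powr p) + B / (A + B) * (norm (g x) powr p / B powr p)))"
    using int(1,2) by (intro integral_mono int(3) norm_add_powr_le assms(1) AB) auto
  also have "\<dots> = (A + B) powr p * (A / (A + B) * (?F / A powr p) + B / (A + B) * (?G / B powr p))"
    using int(1,2) by simp
  also have "\<dots> \<le> (A + B) powr p * (A / (A + B) * 1 + B / (A + B) * 1)"
    using AB FG by (intro mult_left_mono add_mono) auto
  also have "\<dots> = (A + B) powr p"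
    using AB by (simp add: add_divide_distrib[symmetric])
  finally have "Lp_norm \<Omega> p (\<lambda>x. f x + g x) \<le> A + B"
    using AB assms(1) by (intro Lp_norm_leI) auto
  then show "Lp_norm \<Omega> p (\<lambda>x. f x + g x) \<le> Lp_norm \<Omega> p f + Lp_norm \<Omega> p g + e"
    by (simp add: A_def B_def)
qed

text \<open>It moves membership and norm estimates between almost everywhere equal versions of a
  weak gradient, and from a gradient to its component along \<sigma>.\<close>

lemma Lp_mono_AE:
  assumes "p \<ge> 1" "f \<in> Lp \<Omega> p" "g \<in> borel_measurable (lebesgue_on \<Omega>)"
    "AE x in lebesgue_on \<Omega>. norm (g x) \<le> norm (f x)"
  shows "g \<in> Lp \<Omega> p" "Lp_norm \<Omega> p g \<le> Lp_norm \<Omega> p f"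
proof -
  note [measurable] = assms(3)
  have f: "integrable (lebesgue_on \<Omega>) (\<lambda>x. norm (f x) powr p)"
    using assms by (simp add: Lp_def)
  have le: "AE x in lebesgue_on \<Omega>. norm (g x) powr p \<le> norm (f x) powr p"
    using assms(4) by eventually_elim (use assms(1) in \<open>auto intro: powr_mono2\<close>)
  have g: "integrable (lebesgue_on \<Omega>) (\<lambda>x. norm (g x) powr p)"
    by (rule Bochner_Integration.integrable_bound[OF f]) (use le in auto)
  then show "g \<in> Lp \<Omega> p"
    using assms(3) by (simp add: Lp_def)
  have "(LINT x|lebesgue_on \<Omega>. norm (g x) powr p) \<le> Lp_norm \<Omega> p f powr p"
    unfolding Lp_norm_powr[OF assms(1)] by (rule integral_mono_AE[OF g f le])
  then show "Lp_norm \<Omega> p g \<le> Lp_norm \<Omega> p f"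
    using assms(1) by (intro Lp_norm_leI Lp_norm_nonneg)
qed

lemma continuous_compact_support_Lp:
  fixes f :: "'a::euclidean_space \<Rightarrow> 'b::euclidean_space"
  assumes "p \<ge> 1" "\<Omega> \<in> sets lebesgue" "continuous_on UNIV f" "compact K" "\<And>x. x \<notin> K \<Longrightarrow> f x = 0"
  shows "f \<in> Lp \<Omega> p"
proof -
  have "continuous_on UNIV (\<lambda>x. norm (f x) powr p)"
    using assms(1,3) by (intro continuous_on_powr' continuous_intros) auto
  then have *: "integrable lborel (\<lambda>x. norm (f x) powr p)"
    by (rule compact_support_integrable[OF _ assms(4)]) (use assms(5) in auto)
  have "integrable lebesgue (\<lambda>x. norm (f x) powr p)"
    using * integrable_completion[OF borel_measurable_integrable[OF *]] by simp
  then have "integrable (lebesgue_on \<Omega>) (\<lambda>x. norm (f x) powr p)"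
    using assms(2) integrable_mult_indicator[OF assms(2), of "\<lambda>x. norm (f x) powr p"] by (simp add: integrable_restrict_space)
  moreover have "f \<in> borel_measurable (lebesgue_on \<Omega>)"
    using assms(3) by (intro measurable_restrict_space1 measurable_completion)
      (simp add: borel_measurable_continuous_onI)
  ultimately show ?thesis by (simp add: Lp_def)
qed

lemma test_function_Lp:
  assumes "p \<ge> 1" "open \<Omega>" "\<phi> \<in> test_functions \<Omega>"
  shows "\<phi> \<in> Lp \<Omega> p" "gradient \<phi> \<in> Lp \<Omega> p"
proof -
  note \<phi> = test_functionD[OF assms(3)]
  have \<Omega>: "\<Omega> \<in> sets lebesgue" using assms(2) by simp
  show "\<phi> \<in> Lp \<Omega> p"
    by (rule continuous_compact_support_Lp[OF assms(1) \<Omega> _ \<phi>(2)])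
      (use \<phi>(1)[of 0] in simp, rule eq_0_outside_support)
  show "gradient \<phi> \<in> Lp \<Omega> p"
    by (rule continuous_compact_support_Lp[OF assms(1) \<Omega> continuous_on_gradient[OF \<phi>(1)] \<phi>(2)])
      (rule gradient_eq_0_outside_support)
qed

section \<open>The Poincare inequality\<close>

lemma poincare_test_function:
  assumes "p \<ge> 1" "open \<Omega>" "\<phi> \<in> test_functions \<Omega>" "norm \<sigma> = 1"
    and "c > 0" "\<And>x. x \<in> \<Omega> \<Longrightarrow> \<bar>(x - x0) \<bullet> \<sigma>\<bar> < c"
  shows "Lp_norm \<Omega> p \<phi> \<le> c * Lp_norm \<Omega> p (\<lambda>x. gradient \<phi> x \<bullet> \<sigma>)"
proof -
  note \<phi> = test_functionD[OF assms(3)]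
  have \<Omega>: "\<Omega> \<in> sets lebesgue" using assms(2) by simp
  have \<sigma>: "\<sigma> \<bullet> \<sigma> = 1" using assms(4) by (simp add: dot_square_norm)
  define d where "d x = gradient \<phi> x \<bullet> \<sigma>" for x
  have diff: "\<phi> differentiable (at x)" for x
    using \<phi>(1) Ck_differentiable by blast
  have d: "frechet_derivative \<phi> (at x) \<sigma> = d x" "frechet_derivative \<phi> (at x) (- \<sigma>) = - d x" for x
    by (simp_all add: gradient_inner[OF diff, symmetric] d_def)
  have cont: "continuous_on UNIV \<phi>" "continuous_on UNIV d"
    using \<phi>(1)[of 0] continuous_on_gradient[OF \<phi>(1)] by (auto simp: d_def intro: continuous_intros)
  define H where "H = {x. (x - x0) \<bullet> \<sigma> > 0}"
  have H: "H \<in> sets borel" "- H \<in> sets borel"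
    unfolding H_def by measurable
  have out: "x \<notin> \<Omega> \<Longrightarrow> \<phi> x = 0" for x
    using eq_0_outside_support[of x \<phi>] \<phi>(3) by blast
  have dout: "x \<notin> closure {x. \<phi> x \<noteq> 0} \<Longrightarrow> d x = 0" for x
    using gradient_eq_0_outside_support[of x \<phi>] by (simp add: d_def)
  \<comment> \<open>Stated for a general \<open>f\<close>, since it is applied both to \<phi> and to
    its directional derivative \<open>d\<close>.\<close>
  have split: "(LINT x|lebesgue_on \<Omega>. norm (f x) powr p) =
      (LINT x|lborel. indicator H x * \<bar>f x\<bar> powr p) + (LINT x|lborel. indicator (- H) x * \<bar>f x\<bar> powr p)"
    if f: "continuous_on UNIV f" "\<And>x. x \<notin> closure {x. \<phi> x \<noteq> 0} \<Longrightarrow> f x = 0" for f :: "'a \<Rightarrow> real"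
  proof -
    have c: "continuous_on UNIV (\<lambda>x. \<bar>f x\<bar> powr p)"
      using assms(1) f(1) by (intro continuous_on_powr' continuous_intros) auto
    then have int: "integrable lborel (\<lambda>x. \<bar>f x\<bar> powr p)"
      by (rule compact_support_integrable[OF _ \<phi>(2)]) (use f(2) in simp)
    have "(LINT x|lebesgue_on \<Omega>. norm (f x) powr p) = (LINT x|lborel. \<bar>f x\<bar> powr p)"
      unfolding real_norm_def
    proof (rule integral_lebesgue_on_eq_lborel[OF \<Omega> borel_measurable_continuous_onI[OF c]])
      fix x assume "x \<notin> \<Omega>"
      then have "f x = 0" using \<phi>(3) f(2) by blast
      then show "\<bar>f x\<bar> powr p = 0" by simp
    qed
    also have "(\<lambda>x. \<bar>f x\<bar> powr p) = (\<lambda>x. indicator H x * \<bar>f x\<bar> powr p + indicator (- H) x * \<bar>f x\<bar> powr p)"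
      by (intro ext) (simp add: indicator_def)
    also have "(LINT x|lborel. indicator H x * \<bar>f x\<bar> powr p + indicator (- H) x * \<bar>f x\<bar> powr p) =
      (LINT x|lborel. indicator H x * \<bar>f x\<bar> powr p) + (LINT x|lborel. indicator (- H) x * \<bar>f x\<bar> powr p)"
      using integrable_mult_indicator[OF _ int, of H] integrable_mult_indicator[OF _ int, of "- H"] H
      by (intro Bochner_Integration.integral_add) simp_all
    finally show ?thesis .
  qed
  have "(LINT x|lborel. indicator H x * \<bar>\<phi> x\<bar> powr p)
      \<le> c powr p * (LINT x|lborel. indicator H x * \<bar>d x\<bar> powr p)"
    unfolding d(1)[symmetric]
  proof (rule poincare_half_space[OF \<phi>(1,2) H(1) _ assms(5) _ assms(1)])
    show "x + h *\<^sub>R \<sigma> \<in> H" if "x \<in> H" "0 \<le> h" for x h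
      using that \<sigma> by (simp add: H_def inner_diff_left inner_add_left)
    show "\<phi> (x + c *\<^sub>R \<sigma>) = 0" if "x \<in> H" for x
    proof (rule out)
      have "(x + c *\<^sub>R \<sigma> - x0) \<bullet> \<sigma> > c"
        using that \<sigma> by (simp add: H_def inner_diff_left inner_add_left)
      then show "x + c *\<^sub>R \<sigma> \<notin> \<Omega>" using assms(6)[of "x + c *\<^sub>R \<sigma>"] by auto
    qed
  qed
  moreover have "(LINT x|lborel. indicator (- H) x * \<bar>\<phi> x\<bar> powr p)
      \<le> c powr p * (LINT x|lborel. indicator (- H) x * \<bar>- d x\<bar> powr p)"
    unfolding d(2)[symmetric]
  proof (rule poincare_half_space[OF \<phi>(1,2) H(2) _ assms(5) _ assms(1)])
    show "x + h *\<^sub>R - \<sigma> \<in> - H" if "x \<in> - H" "0 \<le> h" for x h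
      using that \<sigma> by (simp add: H_def inner_diff_left)
    show "\<phi> (x + c *\<^sub>R - \<sigma>) = 0" if "x \<in> - H" for x
    proof (rule out)
      \<comment> \<open>Points of the middle hyperplane belong to \<open>- H\<close> and give
        equality here; the strict slab bound still excludes the shifted point from \<Omega>.\<close>
      have "(x + c *\<^sub>R - \<sigma> - x0) \<bullet> \<sigma> \<le> - c"
        using that \<sigma> by (simp add: H_def inner_diff_left)
      then show "x + c *\<^sub>R - \<sigma> \<notin> \<Omega>" using assms(6)[of "x + c *\<^sub>R - \<sigma>"] by auto
    qed
  qed
  ultimately have "(LINT x|lebesgue_on \<Omega>. norm (\<phi> x) powr p)
      \<le> c powr p * (LINT x|lebesgue_on \<Omega>. norm (d x) powr p)"
    using split[OF cont(1) eq_0_outside_support[of _ \<phi>]] split[OF cont(2) dout] by (simp add: distrib_left)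
  also have "\<dots> = (c * Lp_norm \<Omega> p d) powr p"
    using assms(5) by (simp add: powr_mult Lp_norm_nonneg Lp_norm_powr[OF assms(1)])
  finally show ?thesis
    unfolding d_def[abs_def, symmetric] using assms(1,5) by (intro Lp_norm_leI) (auto simp: Lp_norm_nonneg)
qed

section \<open>The constant and the projection\<close>

lemma c_const_eq_projection:
  assumes "norm \<sigma> = 1"
  shows "c_const \<Omega> \<sigma> = (INF t. SUP s\<in>projection \<sigma> \<Omega>. \<bar>s - t\<bar>)"
proof -
  let ?S = "\<lambda>t. SUP s\<in>projection \<sigma> \<Omega>. \<bar>s - t\<bar>"
  \<comment> \<open>The suprema are compared through equality of the underlying sets, so the
    argument also covers empty \<Omega>, where their value is unspecified.\<close>
  have "(\<lambda>x. \<bar>(x - x0) \<bullet> \<sigma>\<bar>) ` \<Omega> = (\<lambda>s. \<bar>s - x0 \<bullet> \<sigma>\<bar>) ` projection \<sigma> \<Omega>" for x0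
    by (auto simp: projection_def inner_diff_left)
  then have "c_const \<Omega> \<sigma> = (INF x0. ?S (x0 \<bullet> \<sigma>))"
    by (simp add: c_const_def)
  also have "range (\<lambda>x0. ?S (x0 \<bullet> \<sigma>)) = range ?S"
  proof -
    \<comment> \<open>The centre enters only through its component along \<sigma>; as \<sigma> is a
      unit vector, t \<sigma> realises every real t.\<close>
    have "?S t = ?S ((t *\<^sub>R \<sigma>) \<bullet> \<sigma>)" for t
      using assms by (simp add: dot_square_norm)
    then show ?thesis by blast
  qed
  finally show ?thesis .
qed

text \<open>Boundedness makes each supremum genuine and a point of \<Omega> makes it nonnegative. So
  the infimum is over a nonempty set bounded below by 0, and any number above it exceeds the
  supremum for some centre.\<close>

lemma
  assumes "bounded_in_direction \<sigma> \<Omega>" "\<Omega> \<noteq> {}"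
  shows c_const_nonneg: "c_const \<Omega> \<sigma> \<ge> 0"
    and c_const_lessE: "c_const \<Omega> \<sigma> < c \<Longrightarrow> (\<And>x0. (\<And>x. x \<in> \<Omega> \<Longrightarrow> \<bar>(x - x0) \<bullet> \<sigma>\<bar> < c) \<Longrightarrow> thesis) \<Longrightarrow> thesis"
proof -
  obtain B where B: "\<And>x. x \<in> \<Omega> \<Longrightarrow> \<bar>x \<bullet> \<sigma>\<bar> \<le> B"
    using assms(1) by (auto simp: bounded_in_direction_def bdd_above_def)
  have "\<bar>(x - x0) \<bullet> \<sigma>\<bar> \<le> B + \<bar>x0 \<bullet> \<sigma>\<bar>" if "x \<in> \<Omega>" for x x0
    using B[OF that] by (simp add: inner_diff_left)
  then have bdd: "bdd_above ((\<lambda>x. \<bar>(x - x0) \<bullet> \<sigma>\<bar>) ` \<Omega>)" for x0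
    by (auto simp: bdd_above_def)
  have nonneg: "0 \<le> (SUP x\<in>\<Omega>. \<bar>(x - x0) \<bullet> \<sigma>\<bar>)" for x0
  proof -
    obtain x where "x \<in> \<Omega>" using assms(2) by blast
    then show ?thesis using cSUP_upper[OF _ bdd[of x0]] by (meson abs_ge_zero order_trans)
  qed
  show "c_const \<Omega> \<sigma> \<ge> 0"
    unfolding c_const_def using nonneg by (intro cINF_greatest) auto
  assume "c_const \<Omega> \<sigma> < c" and *: "\<And>x0. (\<And>x. x \<in> \<Omega> \<Longrightarrow> \<bar>(x - x0) \<bullet> \<sigma>\<bar> < c) \<Longrightarrow> thesis"
  then obtain x0 where "(SUP x\<in>\<Omega>. \<bar>(x - x0) \<bullet> \<sigma>\<bar>) < c"
    unfolding c_const_def using nonneg by (subst (asm) cINF_less_iff) (auto intro!: bdd_belowI[of _ 0])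
  then show thesis
    using * cSUP_upper[OF _ bdd[of x0]] by (meson le_less_trans)
qed

lemma poincare_W1p_0:
  assumes "p \<ge> 1" "open \<Omega>" "u \<in> W1p_0 \<Omega> p" "norm \<sigma> = 1" "bounded_in_direction \<sigma> \<Omega>" "\<Omega> \<noteq> {}"
  shows "Lp_norm \<Omega> p u \<le> c_const \<Omega> \<sigma> * Lp_norm \<Omega> p (weak_dir_deriv \<Omega> \<sigma> u)"
proof -
  let ?N = "Lp_norm \<Omega> p" and ?c = "c_const \<Omega> \<sigma>"
  define W where "W = weak_gradient \<Omega> u"
  define B where "B = ?N (\<lambda>x. W x \<bullet> \<sigma>)"
  note c0 = c_const_nonneg[OF assms(5,6)]
  have u: "u \<in> Lp \<Omega> p" and "\<exists>G\<in>Lp \<Omega> p. has_weak_gradient \<Omega> u G"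
    using assms(3) by (auto simp: W1p_0_def W1p_def)
  then obtain G where G: "G \<in> Lp \<Omega> p" "has_weak_gradient \<Omega> u G" by blast
  have W: "has_weak_gradient \<Omega> u W"
    unfolding W_def by (rule has_weak_gradient_weak_gradient[OF G(2)])
  have meas: "V \<in> borel_measurable (lebesgue_on \<Omega>)" if "has_weak_gradient \<Omega> w V" for w V
    using that L1_loc_measurable[OF assms(2), of V] by (simp add: has_weak_gradient_def)
  have inner: "(\<lambda>x. V x \<bullet> \<sigma>) \<in> Lp \<Omega> p \<and> ?N (\<lambda>x. V x \<bullet> \<sigma>) \<le> ?N V" if "V \<in> Lp \<Omega> p" for V
  proof -
    have "(\<lambda>x. V x \<bullet> \<sigma>) \<in> borel_measurable (lebesgue_on \<Omega>)"
      using that by (auto simp: Lp_def)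
    moreover have "AE x in lebesgue_on \<Omega>. norm (V x \<bullet> \<sigma>) \<le> norm (V x)"
      using Cauchy_Schwarz_ineq2[of "V x" \<sigma> for x] assms(4) by simp
    ultimately show ?thesis
      using Lp_mono_AE[OF assms(1) that] by blast
  qed
  \<comment> \<open>Membership in \<open>W1p\<close> provides some p-integrable gradient
    \<open>G\<close>; the chosen version \<open>W\<close> inherits integrability by
    uniqueness.\<close>
  have W_Lp: "W \<in> Lp \<Omega> p"
    using has_weak_gradient_unique[OF assms(2) W G(2)]
    by (intro Lp_mono_AE(1)[OF assms(1) G(1) meas[OF W]]) (auto elim: eventually_mono)
  have neg: "(\<lambda>x. - f x) \<in> Lp \<Omega> p \<and> ?N (\<lambda>x. - f x) = ?N f" if "f \<in> Lp \<Omega> p" for f :: "'a \<Rightarrow> 'b::euclidean_space"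
    using that by (simp add: Lp_def Lp_norm_def)
  \<comment> \<open>One \<open>e\<close> serves three times: as the distance of u from \<phi>, as
    the distance of their gradients, and as slack in the width of the slab.\<close>
  have "?N u \<le> e + (?c + e) * (B + e)" if "e > 0" for e
  proof -
    obtain \<phi> where \<phi>: "\<phi> \<in> test_functions \<Omega>" "W1p_norm \<Omega> p (\<lambda>x. u x - \<phi> x) < e"
      using assms(3) \<open>e > 0\<close> by (auto simp: W1p_0_def)
    define V where "V = weak_gradient \<Omega> (\<lambda>x. u x - \<phi> x)"
    note \<phi>Lp = test_function_Lp[OF assms(1,2) \<phi>(1)]
    note D = has_weak_gradient_diff[OF assms(2) W test_function_has_weak_gradient[OF assms(2) \<phi>(1)]]
    have V: "has_weak_gradient \<Omega> (\<lambda>x. u x - \<phi> x) V"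
      unfolding V_def by (rule has_weak_gradient_weak_gradient[OF D])
    \<comment> \<open>The choice of a gradient for u - \<phi> is independent of the choice for u, so
      the two are related only through almost everywhere uniqueness.\<close>
    have AE: "AE x in lebesgue_on \<Omega>. V x = W x - gradient \<phi> x"
      by (rule has_weak_gradient_unique[OF assms(2) V D])
    have diff: "(\<lambda>x. W x - gradient \<phi> x) \<in> Lp \<Omega> p" "(\<lambda>x. u x - \<phi> x) \<in> Lp \<Omega> p"
      using Lp_add[OF assms(1) W_Lp conjunct1[OF neg[OF \<phi>Lp(2)]]]
        Lp_add[OF assms(1) u conjunct1[OF neg[OF \<phi>Lp(1)]]] by simp_all
    have V_Lp: "V \<in> Lp \<Omega> p"
      using AE by (intro Lp_mono_AE(1)[OF assms(1) diff(1) meas[OF V]]) (auto elim: eventually_mono)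
    have small: "?N (\<lambda>x. u x - \<phi> x) \<le> e" "?N V \<le> e"
      using \<phi>(2) Lp_norm_nonneg[of \<Omega> p "\<lambda>x. u x - \<phi> x"] Lp_norm_nonneg[of \<Omega> p V]
      by (auto simp: W1p_norm_def V_def)
    note V\<sigma> = inner[OF V_Lp] and W\<sigma> = inner[OF W_Lp]
    have "?N (\<lambda>x. gradient \<phi> x \<bullet> \<sigma>) \<le> ?N (\<lambda>x. W x \<bullet> \<sigma> + - (V x \<bullet> \<sigma>))"
    proof (rule Lp_mono_AE(2)[OF assms(1)])
      show "(\<lambda>x. W x \<bullet> \<sigma> + - (V x \<bullet> \<sigma>)) \<in> Lp \<Omega> p"
        using Lp_add[OF assms(1) conjunct1[OF W\<sigma>] conjunct1[OF neg[OF conjunct1[OF V\<sigma>]]]] .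
      show "(\<lambda>x. gradient \<phi> x \<bullet> \<sigma>) \<in> borel_measurable (lebesgue_on \<Omega>)"
        using inner[OF \<phi>Lp(2)] by (simp add: Lp_def)
      show "AE x in lebesgue_on \<Omega>. norm (gradient \<phi> x \<bullet> \<sigma>) \<le> norm (W x \<bullet> \<sigma> + - (V x \<bullet> \<sigma>))"
        using AE by eventually_elim (simp add: inner_diff_left)
    qed
    also have "\<dots> \<le> B + ?N (\<lambda>x. - (V x \<bullet> \<sigma>))"
      unfolding B_def
      using Lp_norm_triangle[OF assms(1) conjunct1[OF W\<sigma>] conjunct1[OF neg[OF conjunct1[OF V\<sigma>]]]] .
    also have "\<dots> \<le> B + e"
      using neg[OF conjunct1[OF V\<sigma>]] V\<sigma> small(2) by linarith
    finally have grad: "?N (\<lambda>x. gradient \<phi> x \<bullet> \<sigma>) \<le> B + e" .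
    \<comment> \<open>An infimum need not be attained; the slack yields a centre together with a
      positive half-width and strict bounds.\<close>
    obtain x0 where x0: "\<And>x. x \<in> \<Omega> \<Longrightarrow> \<bar>(x - x0) \<bullet> \<sigma>\<bar> < ?c + e"
      using c_const_lessE[OF assms(5,6), of "?c + e"] \<open>e > 0\<close> by auto
    have "?N u \<le> ?N (\<lambda>x. u x - \<phi> x) + ?N \<phi>"
      using Lp_norm_triangle[OF assms(1) diff(2) \<phi>Lp(1)] by simp
    also have "?N \<phi> \<le> (?c + e) * ?N (\<lambda>x. gradient \<phi> x \<bullet> \<sigma>)"
      using \<open>e > 0\<close> c0 by (intro poincare_test_function[OF assms(1,2) \<phi>(1) assms(4) _ x0]) auto
    also have "\<dots> \<le> (?c + e) * (B + e)"
      using \<open>e > 0\<close> c0 by (intro mult_left_mono grad) auto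
    finally show ?thesis using small(1) by linarith
  qed
  moreover have "((\<lambda>e. e + (?c + e) * (B + e)) \<longlongrightarrow> 0 + (?c + 0) * (B + 0)) (at_right 0)"
    by (intro tendsto_intros)
  ultimately have "?N u \<le> 0 + (?c + 0) * (B + 0)"
    by (intro tendsto_lowerbound) (auto simp: eventually_at_right_less intro: eventually_mono[OF eventually_at_right_less])
  then show ?thesis
    by (simp add: B_def W_def weak_dir_deriv_def)
qed

theorem theorem2p1:
  fixes \<Omega> :: "(real ^ 'n) set" and \<sigma> :: "real ^ 'n"
  assumes "open \<Omega>"
    and "\<sigma> \<in> sphere 0 1"
    and "bounded_in_direction \<sigma> \<Omega>"
  shows "(\<forall>p\<ge>1. \<forall>u \<in> W1p_0 \<Omega> p.
            Lp_norm \<Omega> p u \<le> p * c_const \<Omega> \<sigma> * Lp_norm \<Omega> p (weak_dir_deriv \<Omega> \<sigma> u))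
       \<and> (\<forall>\<Omega>' :: (real ^ 'n) set. \<forall>\<sigma>' \<in> sphere 0 1.
            open \<Omega>' \<and> projection \<sigma>' \<Omega>' = projection \<sigma> \<Omega> \<longrightarrow> c_const \<Omega>' \<sigma>' = c_const \<Omega> \<sigma>)"
proof (intro conjI allI impI ballI)
  fix p u assume p: "1 \<le> p" and u: "u \<in> W1p_0 \<Omega> p"
  show "Lp_norm \<Omega> p u \<le> p * c_const \<Omega> \<sigma> * Lp_norm \<Omega> p (weak_dir_deriv \<Omega> \<sigma> u)"
  proof (cases "\<Omega> = {}")
    \<comment> \<open>Integrals over the empty set are 0 and \<open>0 powr (1 / p)\<close> is 0, so
      both sides vanish whatever the unspecified value of \<open>c_const\<close>.\<close>
    case True
    then show ?thesis by (simp add: Lp_norm_def)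
  next
    case False
    have "Lp_norm \<Omega> p u \<le> c_const \<Omega> \<sigma> * Lp_norm \<Omega> p (weak_dir_deriv \<Omega> \<sigma> u)"
      using poincare_W1p_0[OF p assms(1) u _ assms(3) False] assms(2) by simp
    \<comment> \<open>The right-hand side is nonnegative and p \<ge> 1, so inserting the factor p
      only enlarges it.\<close>
    also have "\<dots> \<le> p * (c_const \<Omega> \<sigma> * Lp_norm \<Omega> p (weak_dir_deriv \<Omega> \<sigma> u))"
      using mult_right_mono[OF p mult_nonneg_nonneg[OF c_const_nonneg[OF assms(3) False] Lp_norm_nonneg]]
      by simp
    finally show ?thesis by (simp add: mult.assoc)
  qed
next
  fix \<Omega>' :: "(real ^ 'n) set" and \<sigma>' :: "real ^ 'n"
  assume "\<sigma>' \<in> sphere 0 1" "open \<Omega>' \<and> projection \<sigma>' \<Omega>' = projection \<sigma> \<Omega>"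
  then show "c_const \<Omega>' \<sigma>' = c_const \<Omega> \<sigma>"
    using assms(2) by (simp add: c_const_eq_projection)
qed

end
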